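(* Let $R$ be $\mathbb{Z}$ or a field of characteristic $0$, and let $(\mathbf{x},\rho,B)$ be a generalized seed over $R$. Assume that all the generalized seeds mutation-equivalent to $(\mathbf{x},\rho,B)$ are coprime. Then the upper bound $S_{\mathbf{x}}$ is independent of the choice of generalized seed mutation-equivalent to $(\mathbf{x},\rho,B)$ (that is, $S_{\mathbf{y}}=S_{\mathbf{x}}$ for the cluster $\mathbf{y}$ of every such seed), and so it is equal to the generalized upper cluster algebra $\mathcal{U}(\mathbf{x},\rho,B)$.
   Context: Here $[a,b]$ denotes the set of integers $x$ with $a\le x\le b$; $[x]_+=\max(x,0)$; $\mathbf{q}(R)$ is the quotient field of $R$. Let $n,m\ge 0$ be integers with $n+m>0$, and let the ambient field $\mathcal{F}$ be the rational function field in $n+m$ independent variables over $\mathbf{q}(R)$. An exchange matrix is an $(n+m)\times n$ integer matrix $B=(b_{ij})$ whose submatrix on the first $n$ rows is skew-symmetrizable, i.e. becomes skew-symmetric after left multiplication by some diagonal matrix with positive integer diagonal entries. Fix positive integers $d_1,\dots,d_n$ such that $\beta_{ji}:=b_{ji}/d_i\in\mathbb{Z}$ for all $i\in[1,n]$, $j\in[1,n+m]$. A generalized seed of rank $n$ is a triple $(\mathbf{x},\rho,B)$ where $\mathbf{x}=\{x_1,\dots,x_{n+m}\}\subseteq\mathcal{F}$ is a cluster, i.e. a set of $n+m$ elements algebraically independent over $R$ ($x_1,\dots,x_n$ are the cluster variables and $x_{n+1},\dots,x_{n+m}$ the frozen variables); $B$ is an exchange matrix; and $\rho=\{\rho_i\mid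 i\in[1,n]\}$ with $\rho_i=\{\rho_{i,0},\dots,\rho_{i,d_i}\}$, $\rho_{i,0}=\rho_{i,d_i}=1$ and $\rho_{i,j}$ a monomial (with coefficient in $R$) in $R[x_{n+1},\dots,x_{n+m}]$ for $j\in[1,d_i-1]$. Its exchange polynomials are, for $i\in[1,n]$, $$f_i=\sum_{j=0}^{d_i}\rho_{i,j}\prod_{k=1}^{n+m}x_k^{\,j[\beta_{ki}]_++(d_i-j)[-\beta_{ki}]_+}\in R[\mathbf{x}].$$ The mutation of $(\mathbf{x},\rho,B)$ in direction $i\in[1,n]$ is the generalized seed $\mu_i(\mathbf{x},\rho,B)=(\mathbf{x}_i,\rho',B_i)$ (with the same $d_1,\dots,d_n$), where $\mathbf{x}_i=(\mathbf{x}\setminus\{x_i\})\cup\{x_i'\}$ with $x_i'=f_i/x_i$; $\rho'$ is obtained from $\rho$ by replacing $\rho_i$ by $\rho_i'$, $\rho'_{i,j}=\rho_{i,d_i-j}$; and $B_i=(b'_{kl})$ with $b'_{kl}=-b_{kl}$ if $k=i$ or $l=i$, and $b'_{kl}=b_{kl}+[b_{il}]_+b_{ki}+b_{il}[-b_{ki}]_+$ otherwise. Two generalized seeds are mutation-equivalent if one is obtained from the other by a finite sequence of mutations. A generalized seed is coprime if its exchange polynomials $f_1,\dots,f_n$ are pairwise coprime in $R[\mathbf{x}]$. For a cluster $\mathbf{y}$, $L_{\mathbf{y}}=R[y_1^{\pm1},\dots,y_{n+m}^{\pm1}]$. The generalized upper cluster algebra $\mathcal{U}(\mathbf{x},\rho,B)$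 is the intersection $\bigcap L_{\mathbf{y}}$ over the clusters $\mathbf{y}$ of all generalized seeds mutation-equivalent to $(\mathbf{x},\rho,B)$. For a generalized seed with cluster $\mathbf{y}$, put $\mathbf{y}_0=\mathbf{y}$ and let $\mathbf{y}_i$ be the cluster obtained by mutating in direction $i\in[1,n]$; the upper bound is $S_{\mathbf{y}}=\bigcap_{i=0}^nL_{\mathbf{y}_i}$. *)

theory Defs
  imports Complex_Main "HOL-Library.Poly_Mapping"
begin

(* Everything happens inside a field 'a of characteristic 0: the ground ring R and the ambient
   field F are subsets of it.  Clusters and matrices are functions on nat, of which only the
   indices 1..n+m (rows, cluster elements) and 1..n (columns, mutation directions) matter. *)

section \<open>Subrings, rational function fields\<close>

definition is_subring :: "'a::field set \<Rightarrow> bool" where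
  "is_subring A \<longleftrightarrow> 1 \<in> A \<and> (\<forall>a\<in>A. \<forall>b\<in>A. a - b \<in> A \<and> a * b \<in> A)"

definition is_subfield :: "'a::field set \<Rightarrow> bool" where
  "is_subfield A \<longleftrightarrow> is_subring A \<and> (\<forall>a\<in>A. inverse a \<in> A)"

definition quotient_field :: "'a::field set \<Rightarrow> 'a set" where
  "quotient_field R = is_subfield hull R"

definition poly_ring :: "'a::field set \<Rightarrow> (nat \<Rightarrow> 'a) \<Rightarrow> nat set \<Rightarrow> 'a set" where
  "poly_ring R x V = is_subring hull (R \<union> x ` V)"

definition laurent_ring :: "'a::field set \<Rightarrow> (nat \<Rightarrow> 'a) \<Rightarrow> nat set \<Rightarrow> 'a set" where
  "laurent_ring R x V = is_subring hull (R \<union> x ` V \<union> (\<lambda>k. inverse (x k)) ` V)"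

definition mpolys :: "'a::field set \<Rightarrow> nat set \<Rightarrow> ((nat \<Rightarrow>\<^sub>0 nat) \<Rightarrow>\<^sub>0 'a) set" where
  "mpolys R V = {p. \<forall>e \<in> Poly_Mapping.keys p.
                      Poly_Mapping.lookup p e \<in> R \<and> Poly_Mapping.keys e \<subseteq> V}"

definition mpoly_eval :: "(nat \<Rightarrow> 'a::field) \<Rightarrow> ((nat \<Rightarrow>\<^sub>0 nat) \<Rightarrow>\<^sub>0 'a) \<Rightarrow> 'a" where
  "mpoly_eval x p = (\<Sum>e \<in> Poly_Mapping.keys p. Poly_Mapping.lookup p e *
                       (\<Prod>k \<in> Poly_Mapping.keys e. x k ^ Poly_Mapping.lookup e k))"

definition alg_independent :: "'a::field set \<Rightarrow> (nat \<Rightarrow> 'a) \<Rightarrow> nat set \<Rightarrow> bool" where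
  "alg_independent R x V \<longleftrightarrow> (\<forall>p \<in> mpolys R V. mpoly_eval x p = 0 \<longrightarrow> p = 0)"

definition is_rational_function_field :: "'a::field set \<Rightarrow> nat \<Rightarrow> 'a set \<Rightarrow> bool" where
  "is_rational_function_field K N F \<longleftrightarrow>
     (\<exists>z. alg_independent K z {1..N} \<and> F = is_subfield hull (K \<union> z ` {1..N}))"

(* Coprimality in the ring A: same definition as the library's coprime, relative to a carrier. *)
definition divides_in :: "'a::field set \<Rightarrow> 'a \<Rightarrow> 'a \<Rightarrow> bool" where
  "divides_in A a b \<longleftrightarrow> (\<exists>c\<in>A. b = a * c)"

definition coprime_in :: "'a::field set \<Rightarrow> 'a \<Rightarrow> 'a \<Rightarrow> bool" where
  "coprime_in A a b \<longleftrightarrow>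
     (\<forall>c\<in>A. divides_in A c a \<longrightarrow> divides_in A c b \<longrightarrow> divides_in A c 1)"

section \<open>Generalized seeds\<close>

definition exchange_matrix :: "nat \<Rightarrow> (nat \<Rightarrow> nat \<Rightarrow> int) \<Rightarrow> bool" where
  "exchange_matrix n B \<longleftrightarrow>
     (\<exists>s::nat \<Rightarrow> int. (\<forall>k\<in>{1..n}. s k > 0) \<and>
        (\<forall>k\<in>{1..n}. \<forall>l\<in>{1..n}. s k * B k l = - (s l * B l k)))"

type_synonym 'a gseed = "(nat \<Rightarrow> 'a) \<times> (nat \<Rightarrow> nat \<Rightarrow> 'a) \<times> (nat \<Rightarrow> nat \<Rightarrow> int)"

abbreviation cluster :: "'a gseed \<Rightarrow> nat \<Rightarrow> 'a" where
  "cluster s \<equiv> fst s"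

definition frozen_monomial ::
  "'a::field set \<Rightarrow> nat \<Rightarrow> nat \<Rightarrow> (nat \<Rightarrow> 'a) \<Rightarrow> 'a \<Rightarrow> bool" where
  "frozen_monomial R n m x r \<longleftrightarrow>
     (\<exists>c\<in>R. \<exists>a::nat \<Rightarrow> nat. r = c * (\<Prod>k\<in>{n+1..n+m}. x k ^ a k))"

fun generalized_seed ::
  "'a::field set \<Rightarrow> 'a set \<Rightarrow> nat \<Rightarrow> nat \<Rightarrow> (nat \<Rightarrow> nat) \<Rightarrow> 'a gseed \<Rightarrow> bool" where
  "generalized_seed R F n m d (x, \<rho>, B) \<longleftrightarrow>
     x ` {1..n+m} \<subseteq> F \<and> alg_independent R x {1..n+m} \<and>
     exchange_matrix n B \<and>
     (\<forall>i\<in>{1..n}. d i > 0 \<and> (\<forall>j\<in>{1..n+m}. int (d i) dvd B j i)) \<and>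
     (\<forall>i\<in>{1..n}. \<rho> i 0 = 1 \<and> \<rho> i (d i) = 1 \<and>
        (\<forall>j\<in>{1..d i - 1}. frozen_monomial R n m x (\<rho> i j)))"

(* On integers, nat z is the positive part of z; the division by d i is exact on seeds. *)
fun exchange_poly ::
  "nat \<Rightarrow> nat \<Rightarrow> (nat \<Rightarrow> nat) \<Rightarrow> 'a::field gseed \<Rightarrow> nat \<Rightarrow> 'a" where
  "exchange_poly n m d (x, \<rho>, B) i =
     (\<Sum>j\<in>{0..d i}. \<rho> i j *
        (\<Prod>k\<in>{1..n+m}. x k ^ (j * nat (B k i div int (d i)) +
                               (d i - j) * nat (- (B k i div int (d i))))))"

definition mutate_matrix :: "nat \<Rightarrow> (nat \<Rightarrow> nat \<Rightarrow> int) \<Rightarrow> nat \<Rightarrow> nat \<Rightarrow> int" where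
  "mutate_matrix i B = (\<lambda>k l. if k = i \<or> l = i then - B k l
     else B k l + max (B i l) 0 * B k i + B i l * max (- B k i) 0)"

fun mutate :: "nat \<Rightarrow> nat \<Rightarrow> (nat \<Rightarrow> nat) \<Rightarrow> nat \<Rightarrow> 'a::field gseed \<Rightarrow> 'a gseed" where
  "mutate n m d i (x, \<rho>, B) =
     (x(i := exchange_poly n m d (x, \<rho>, B) i / x i),
      \<rho>(i := (\<lambda>j. \<rho> i (d i - j))),
      mutate_matrix i B)"

(* The mutation of a generalized seed is again one provided the exchange polynomial is nonzero;
   it can only vanish if column i of B is zero and the coefficients of f_i add up to 0.  The
   mutation formulas are applied in that degenerate case too (the new element is then 0),
   so no nonvanishing hypothesis is needed. *)
definition mutation_equivalent ::
  "nat \<Rightarrow> nat \<Rightarrow> (nat \<Rightarrow> nat) \<Rightarrow> 'a::field gseed \<Rightarrow> 'a gseed \<Rightarrow> bool" where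
  "mutation_equivalent n m d = (\<lambda>s t. \<exists>i\<in>{1..n}. t = mutate n m d i s)\<^sup>*\<^sup>*"

definition coprime_seed ::
  "'a::field set \<Rightarrow> nat \<Rightarrow> nat \<Rightarrow> (nat \<Rightarrow> nat) \<Rightarrow> 'a gseed \<Rightarrow> bool" where
  "coprime_seed R n m d s \<longleftrightarrow>
     (\<forall>i\<in>{1..n}. \<forall>j\<in>{1..n}. i \<noteq> j \<longrightarrow>
        coprime_in (poly_ring R (cluster s) {1..n+m})
          (exchange_poly n m d s i) (exchange_poly n m d s j))"

section \<open>Upper cluster algebra and upper bound\<close>

definition gen_upper_cluster_algebra ::
  "'a::field set \<Rightarrow> nat \<Rightarrow> nat \<Rightarrow> (nat \<Rightarrow> nat) \<Rightarrow> 'a gseed \<Rightarrow> 'a set" where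
  "gen_upper_cluster_algebra R n m d s =
     (\<Inter>t \<in> {t. mutation_equivalent n m d s t}. laurent_ring R (cluster t) {1..n+m})"

definition upper_bound ::
  "'a::field set \<Rightarrow> nat \<Rightarrow> nat \<Rightarrow> (nat \<Rightarrow> nat) \<Rightarrow> 'a gseed \<Rightarrow> 'a set" where
  "upper_bound R n m d s =
     laurent_ring R (cluster s) {1..n+m} \<inter>
     (\<Inter>i\<in>{1..n}. laurent_ring R (cluster (mutate n m d i s)) {1..n+m})"

end

theory Submission
  imports Defs "HOL-Computational_Algebra.Polynomial"
begin

text \<open>
  Write \<open>L(s)\<close> for the Laurent polynomial ring of the cluster of a seed \<open>s\<close>, and \<open>\<mu>\<^sub>i s\<close> for its mutation
  in direction \<open>i\<close>. Suppose first that no exchange polynomial of the given seed vanishes. This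
  persists under mutation, and mutating twice in one direction restores the cluster. The theorem
  then follows from one local statement, \<open>laurent_ring_exchange_inclusion\<close>: for \<open>i \<noteq> j\<close>,
  \<open>L(\<mu>\<^sub>i s) \<inter> L(\<mu>\<^sub>j s) \<subseteq> L(\<mu>\<^sub>j (\<mu>\<^sub>i s))\<close>. Indeed it says that the upper bound of \<open>s\<close> is contained in
  that of \<open>\<mu>\<^sub>i s\<close> (the remaining ring \<open>L(\<mu>\<^sub>i (\<mu>\<^sub>i s))\<close> is \<open>L(s)\<close>), and the same statement for
  \<open>\<mu>\<^sub>i s\<close> gives the opposite inclusion. A constant upper bound lies in every \<open>L(t)\<close>, hence in the
  upper cluster algebra, which is contained in the upper bound by definition.

  For the local statement let \<open>u = f\<^sub>i / x\<^sub>i\<close>, let \<open>g\<close> be the \<open>j\<close>-th exchange polynomial of \<open>\<mu>\<^sub>i s\<close>,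
  \<open>v = g / x\<^sub>j\<close>, \<open>w = f\<^sub>j / x\<^sub>j\<close>, and \<open>L = L(\<mu>\<^sub>j (\<mu>\<^sub>i s))\<close>, whose cluster contains \<open>u\<close> and \<open>v\<close>. An element
  of \<open>L(\<mu>\<^sub>i s)\<close> lies in \<open>L\<close> after multiplication by a power of \<open>g\<close>, and an element of \<open>L(\<mu>\<^sub>j s)\<close>
  after multiplication by a power of \<open>x\<^sub>i w\<close>, once \<open>x\<^sub>i\<close> and \<open>w\<close> are known to lie in \<open>L\<close>. So it
  suffices that \<open>x\<^sub>i w\<close> is not a zero divisor modulo \<open>g\<close> in \<open>L\<close> (\<open>mem_if_two_denominators\<close>). There
  are two reasons for this.

  \<^item> If \<open>b\<^sub>i\<^sub>j = 0\<close>, then \<open>x\<^sub>i w\<close> is \<open>f\<^sub>i\<close> up to a unit of \<open>L\<close>, and \<open>f\<^sub>i\<close>, \<open>g\<close> are exchange polynomials of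
    \<open>\<mu>\<^sub>j (\<mu>\<^sub>i s)\<close>, hence coprime. To use this one needs Euclid's lemma in \<open>R[x\<^sub>1, \<dots>, x\<^sub>n\<^sub>+\<^sub>m]\<close>, that is,
    that polynomial rings over GCD domains are GCD domains (\<open>gcd_subring_polys_over\<close>).
  \<^item> If \<open>b\<^sub>i\<^sub>j \<noteq> 0\<close>, put \<open>t = 1/v\<close> and let \<open>D\<close> be the Laurent ring
    of the other variables, so \<open>L = D[t, 1/t]\<close>, \<open>x\<^sub>j = t g\<close> and \<open>g \<in> D\<close>. The polynomial \<open>f\<^sub>i\<close> is a
    monomial \<open>c\<close> plus a multiple of \<open>x\<^sub>j\<close>, so \<open>x\<^sub>i \<equiv> c/u\<close> modulo \<open>t\<close>; and the mutation rule is
    made so that \<open>f\<^sub>j\<close> at \<open>x\<^sub>i = c/u\<close> is a unit of \<open>D\<close> times \<open>g\<close>, so that also \<open>t w\<close> is congruent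
    modulo \<open>t\<close> to a unit of \<open>D\<close>. A polynomial in \<open>t\<close> whose constant term is a unit is
    a non-zero-divisor modulo any element of \<open>D\<close> (\<open>laurent_ring_nonzerodivisor\<close>).

  It remains to treat a vanishing exchange polynomial \<open>f\<^sub>i\<close> of the given seed. Then the \<open>i\<close>-th column of the matrix is
  zero, and \<open>f\<^sub>i\<close> vanishes for every mutation-equivalent seed. Being coprime to \<open>0\<close>, all other
  exchange polynomials are units, so no mutation changes the Laurent ring of the cluster in
  which \<open>x\<^sub>i\<close> is replaced by \<open>0\<close>, and this ring is the upper bound of every seed.
\<close>

section \<open>Subrings of a field\<close>

lemma subring_1: "is_subring A \<Longrightarrow> 1 \<in> A"
  and subring_diff: "is_subring A \<Longrightarrow> a \<in> A \<Longrightarrow> b \<in> A \<Longrightarrow> a - b \<in> A"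
  and subring_mult: "is_subring A \<Longrightarrow> a \<in> A \<Longrightarrow> b \<in> A \<Longrightarrow> a * b \<in> A"
  by (auto simp: is_subring_def)

lemma subring_0: "is_subring A \<Longrightarrow> 0 \<in> A"
  using subring_diff[of A 1 1] subring_1[of A] by simp

lemma subring_uminus: "is_subring A \<Longrightarrow> a \<in> A \<Longrightarrow> - a \<in> A"
  using subring_diff[of A 0 a] subring_0[of A] by simp

lemma subring_add: "is_subring A \<Longrightarrow> a \<in> A \<Longrightarrow> b \<in> A \<Longrightarrow> a + b \<in> A"
  using subring_diff[of A a "- b"] subring_uminus[of A b] by simp

lemma subring_sum: "is_subring A \<Longrightarrow> (\<And>i. i \<in> I \<Longrightarrow> f i \<in> A) \<Longrightarrow> sum f I \<in> A"
  by (induction I rule: infinite_finite_induct) (auto intro: subring_0 subring_add)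

lemma subring_prod: "is_subring A \<Longrightarrow> (\<And>i. i \<in> I \<Longrightarrow> f i \<in> A) \<Longrightarrow> prod f I \<in> A"
  by (induction I rule: infinite_finite_induct) (auto intro: subring_1 subring_mult)

lemma subring_power: "is_subring A \<Longrightarrow> a \<in> A \<Longrightarrow> a ^ k \<in> A"
  by (induction k) (auto intro: subring_1 subring_mult)

lemmas subring_intros =
  subring_1 subring_0 subring_uminus subring_diff subring_mult subring_add
  subring_sum subring_prod subring_power

lemma is_subring_hull: "is_subring (is_subring hull S)"
  unfolding hull_def is_subring_def by blast

lemma is_subring_poly_ring: "is_subring (poly_ring R x V)"
  and is_subring_laurent_ring: "is_subring (laurent_ring R x V)"
  by (auto simp: poly_ring_def laurent_ring_def is_subring_hull)

lemma coeff_in_poly_ring: "r \<in> R \<Longrightarrow> r \<in> poly_ring R x V"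
  and var_in_poly_ring: "k \<in> V \<Longrightarrow> x k \<in> poly_ring R x V"
  by (auto simp: poly_ring_def intro: hull_inc)

lemma coeff_in_laurent_ring: "r \<in> R \<Longrightarrow> r \<in> laurent_ring R x V"
  and var_in_laurent_ring: "k \<in> V \<Longrightarrow> x k \<in> laurent_ring R x V"
  and inverse_in_laurent_ring: "k \<in> V \<Longrightarrow> inverse (x k) \<in> laurent_ring R x V"
  by (auto simp: laurent_ring_def intro: hull_inc)

lemma poly_ring_least:
  "is_subring A \<Longrightarrow> R \<subseteq> A \<Longrightarrow> (\<And>k. k \<in> V \<Longrightarrow> x k \<in> A) \<Longrightarrow> poly_ring R x V \<subseteq> A"
  unfolding poly_ring_def by (rule hull_minimal) auto

lemma laurent_ring_least:
  "is_subring A \<Longrightarrow> R \<subseteq> A \<Longrightarrow> (\<And>k. k \<in> V \<Longrightarrow> x k \<in> A) \<Longrightarrow>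
   (\<And>k. k \<in> V \<Longrightarrow> inverse (x k) \<in> A) \<Longrightarrow> laurent_ring R x V \<subseteq> A"
  unfolding laurent_ring_def by (rule hull_minimal) auto

lemma poly_ring_mono: "V \<subseteq> W \<Longrightarrow> poly_ring R x V \<subseteq> poly_ring R x W"
  by (rule poly_ring_least)
     (auto intro: is_subring_poly_ring coeff_in_poly_ring var_in_poly_ring)

lemma laurent_ring_mono: "V \<subseteq> W \<Longrightarrow> laurent_ring R x V \<subseteq> laurent_ring R x W"
  by (rule laurent_ring_least)
     (auto intro: is_subring_laurent_ring coeff_in_laurent_ring var_in_laurent_ring
        inverse_in_laurent_ring)

lemma poly_ring_subset_laurent_ring: "poly_ring R x V \<subseteq> laurent_ring R x V"
  by (rule poly_ring_least)
     (auto intro: is_subring_laurent_ring coeff_in_laurent_ring var_in_laurent_ring)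

lemma poly_ring_cong: "(\<And>k. k \<in> V \<Longrightarrow> x k = y k) \<Longrightarrow> poly_ring R x V = poly_ring R y V"
  unfolding poly_ring_def by (simp cong: image_cong)

text \<open>Localizing a ring at the powers of one element gives a ring. Together with the minimality of
  Laurent rings this shows that a common denominator for the generators is, up to a power, a
  denominator for every element; all denominators below are found in this way.\<close>

lemma is_subring_denominators:
  assumes A: "is_subring A" and s: "s \<in> A"
  shows "is_subring {y. \<exists>N. y * s ^ N \<in> A}"
  unfolding is_subring_def
proof (intro conjI ballI)
  show "1 \<in> {y. \<exists>N. y * s ^ N \<in> A}"
    using A by (auto intro!: exI[of _ 0] simp: subring_1)
next
  fix a b assume "a \<in> {y. \<exists>N. y * s ^ N \<in> A}" "b \<in> {y. \<exists>N. y * s ^ N \<in> A}"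
  then obtain M N where MN: "a * s ^ M \<in> A" "b * s ^ N \<in> A" by blast
  have "(a - b) * s ^ (M + N) = (a * s ^ M) * s ^ N - (b * s ^ N) * s ^ M"
    by (simp add: power_add algebra_simps)
  also have "\<dots> \<in> A"
    using A s MN by (simp add: subring_diff subring_mult subring_power)
  finally show "a - b \<in> {y. \<exists>N. y * s ^ N \<in> A}" by blast
  have "(a * b) * s ^ (M + N) = (a * s ^ M) * (b * s ^ N)"
    by (simp add: power_add algebra_simps)
  also have "\<dots> \<in> A" using A MN by (rule subring_mult)
  finally show "a * b \<in> {y. \<exists>N. y * s ^ N \<in> A}" by blast
qed

lemma laurent_ring_clear_denominators:
  assumes A: "is_subring A" "R \<subseteq> A" and s: "s \<in> A"
    and "\<And>k. k \<in> V \<Longrightarrow> x k * s \<in> A" and "\<And>k. k \<in> V \<Longrightarrow> inverse (x k) * s \<in> A"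
    and y: "y \<in> laurent_ring R x V"
  obtains N where "y * s ^ N \<in> A"
proof -
  have "A \<subseteq> {y. \<exists>N. y * s ^ N \<in> A}" "{y. y * s \<in> A} \<subseteq> {y. \<exists>N. y * s ^ N \<in> A}"
    by (auto intro: exI[of _ 0] exI[of _ 1])
  with assms have "laurent_ring R x V \<subseteq> {y. \<exists>N. y * s ^ N \<in> A}"
    by (intro laurent_ring_least is_subring_denominators) blast+
  with y that show ?thesis by blast
qed

lemma laurent_ring_monomial_denominator:
  assumes V: "finite V" and y: "y \<in> laurent_ring R x V"
  obtains N where "y * (\<Prod>k\<in>V. x k) ^ N \<in> poly_ring R x V"
proof (rule laurent_ring_clear_denominators[OF is_subring_poly_ring _ _ _ _ y])
  show "R \<subseteq> poly_ring R x V" by (auto intro: coeff_in_poly_ring)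
  show "(\<Prod>k\<in>V. x k) \<in> poly_ring R x V"
    by (intro subring_prod is_subring_poly_ring var_in_poly_ring)
  show "x k * (\<Prod>k\<in>V. x k) \<in> poly_ring R x V" if "k \<in> V" for k
    using that by (intro subring_mult subring_prod is_subring_poly_ring var_in_poly_ring)
  show "inverse (x k) * (\<Prod>k\<in>V. x k) \<in> poly_ring R x V" if k: "k \<in> V" for k
  proof (cases "x k = 0")
    case True
    then show ?thesis by (simp add: subring_0 is_subring_poly_ring)
  next
    case False
    have "inverse (x k) * (\<Prod>k\<in>V. x k) = (\<Prod>k\<in>V - {k}. x k)"
      using False by (simp add: prod.remove[OF V k] field_simps)
    then show ?thesis
      by (auto intro!: subring_prod is_subring_poly_ring var_in_poly_ring)
  qed
qed (use that in blast)

section \<open>Polynomials with coefficients in a subring\<close>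

definition polys_over :: "'a::field set \<Rightarrow> 'a poly set" where
  "polys_over A = {p. \<forall>i. coeff p i \<in> A}"

definition transcendental_over :: "'a::field set \<Rightarrow> 'a \<Rightarrow> bool" where
  "transcendental_over A t \<longleftrightarrow> (\<forall>p\<in>polys_over A. poly p t = 0 \<longrightarrow> p = 0)"

context
  fixes A :: "'a::field set"
  assumes A: "is_subring A"
begin

lemma polys_over_0: "0 \<in> polys_over A"
  and polys_over_1: "1 \<in> polys_over A"
  and polys_over_add: "p \<in> polys_over A \<Longrightarrow> q \<in> polys_over A \<Longrightarrow> p + q \<in> polys_over A"
  and polys_over_diff: "p \<in> polys_over A \<Longrightarrow> q \<in> polys_over A \<Longrightarrow> p - q \<in> polys_over A"
  and polys_over_mult: "p \<in> polys_over A \<Longrightarrow> q \<in> polys_over A \<Longrightarrow> p * q \<in> polys_over A"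
  and polys_over_smult: "a \<in> A \<Longrightarrow> p \<in> polys_over A \<Longrightarrow> smult a p \<in> polys_over A"
  and polys_over_monom: "a \<in> A \<Longrightarrow> monom a k \<in> polys_over A"
  using A by (auto simp: polys_over_def coeff_mult intro!: subring_intros)

lemma polys_over_pCons: "pCons a p \<in> polys_over A \<longleftrightarrow> a \<in> A \<and> p \<in> polys_over A"
  unfolding polys_over_def
proof (intro iffI CollectI)
  assume "pCons a p \<in> {p. \<forall>i. coeff p i \<in> A}"
  then have *: "\<And>i. coeff (pCons a p) i \<in> A" by simp
  from *[of 0] *[of "Suc _"] show "a \<in> A \<and> p \<in> {p. \<forall>i. coeff p i \<in> A}" by auto
qed (auto simp: coeff_pCons split: nat.split)

lemma coeff_polys_over: "p \<in> polys_over A \<Longrightarrow> coeff p i \<in> A"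
  by (simp add: polys_over_def)

lemma polys_over_sum: "(\<And>i. i \<in> I \<Longrightarrow> f i \<in> polys_over A) \<Longrightarrow> sum f I \<in> polys_over A"
  by (induction I rule: infinite_finite_induct) (auto intro: polys_over_0 polys_over_add)

lemma poly_in_subring:
  assumes "is_subring C" "A \<subseteq> C" "t \<in> C" "p \<in> polys_over A"
  shows "poly p t \<in> C"
  using assms(4)
proof (induction p)
  case (pCons a p)
  then show ?case using assms by (auto simp: polys_over_pCons intro!: subring_intros)
qed (use assms in \<open>simp add: subring_0\<close>)

lemma is_subring_poly_image: "is_subring ((\<lambda>p. poly p t) ` polys_over A)"
  unfolding is_subring_def
proof (intro conjI ballI)
  show "1 \<in> (\<lambda>p. poly p t) ` polys_over A"
    by (rule image_eqI[of _ _ 1]) (auto intro: polys_over_1)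
next
  fix a b assume "a \<in> (\<lambda>p. poly p t) ` polys_over A" "b \<in> (\<lambda>p. poly p t) ` polys_over A"
  then obtain p q where pq: "a = poly p t" "b = poly q t" "p \<in> polys_over A" "q \<in> polys_over A"
    by blast
  show "a - b \<in> (\<lambda>p. poly p t) ` polys_over A"
    using pq by (intro image_eqI[of _ _ "p - q"]) (auto intro: polys_over_diff)
  show "a * b \<in> (\<lambda>p. poly p t) ` polys_over A"
    using pq by (intro image_eqI[of _ _ "p * q"]) (auto intro: polys_over_mult)
qed

lemma coeff_in_poly_image: "a \<in> A \<Longrightarrow> a \<in> (\<lambda>p. poly p t) ` polys_over A"
  by (rule image_eqI[of _ _ "[:a:]"]) (auto simp: polys_over_pCons polys_over_0)

lemma var_in_poly_image: "t \<in> (\<lambda>p. poly p t) ` polys_over A"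
  using A by (intro image_eqI[of _ _ "[:0, 1:]"])
    (auto simp: polys_over_pCons polys_over_0 subring_0 subring_1)

text \<open>If \<open>p(f/t) = 0\<close> with \<open>p\<close> of degree \<open>N\<close>, then multiplication by \<open>t\<^sup>N\<close> turns this into a polynomial equation
  for \<open>t\<close>, whose coefficients are those of \<open>p\<close> in reverse order, multiplied by powers of \<open>f\<close>.\<close>

lemma transcendental_over_divide:
  assumes t: "transcendental_over A t" and f: "f \<in> A" "f \<noteq> 0"
  shows "transcendental_over A (f / t)"
  unfolding transcendental_over_def
proof (intro ballI impI)
  fix p assume p: "p \<in> polys_over A" and root: "poly p (f / t) = 0"
  have t0: "t \<noteq> 0"
  proof
    assume "t = 0"
    then have "poly [:0, 1:] t = 0" by simp
    moreover have "[:0, 1:] \<in> polys_over A"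
      using A by (simp add: polys_over_pCons polys_over_0 subring_0 subring_1)
    ultimately have "[:0, 1 :: 'a:] = 0" using t unfolding transcendental_over_def by blast
    then show False by simp
  qed
  define N where "N = degree p"
  define q where "q = (\<Sum>j\<le>N. monom (coeff p j * f ^ j) (N - j))"
  have "poly q t = (\<Sum>j\<le>N. coeff p j * f ^ j * t ^ (N - j))"
    by (simp add: q_def poly_sum poly_monom)
  also have "\<dots> = (\<Sum>j\<le>N. t ^ N * (coeff p j * (f / t) ^ j))"
  proof (rule sum.cong)
    fix j assume "j \<in> {..N}"
    then have "t ^ N = t ^ j * t ^ (N - j)" by (simp flip: power_add)
    then show "coeff p j * f ^ j * t ^ (N - j) = t ^ N * (coeff p j * (f / t) ^ j)"
      using t0 by (simp add: power_divide field_simps)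
  qed simp
  also have "\<dots> = t ^ N * poly p (f / t)"
    by (simp add: poly_altdef N_def sum_distrib_left)
  finally have "poly q t = 0" using root by simp
  moreover have "q \<in> polys_over A"
    unfolding q_def using p f A
    by (intro polys_over_sum polys_over_monom subring_mult subring_power) (auto simp: coeff_polys_over)
  ultimately have q0: "q = 0" using t by (auto simp: transcendental_over_def)
  have "coeff p j = 0" if "j \<le> N" for j
  proof -
    have "coeff q (N - j) = (\<Sum>i\<le>N. if N - i = N - j then coeff p i * f ^ i else 0)"
      by (simp add: q_def coeff_sum)
    also have "\<dots> = (\<Sum>i\<le>N. if i = j then coeff p i * f ^ i else 0)"
      using that by (intro sum.cong) auto
    also have "\<dots> = coeff p j * f ^ j" using that by simp
    finally show ?thesis using q0 f by simp
  qed
  then show "p = 0"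
    by (intro poly_eqI) (metis N_def coeff_0 coeff_eq_0 linorder_not_less)
qed

end

lemma poly_ring_insert:
  "poly_ring R x (insert k V) = (\<lambda>p. poly p (x k)) ` polys_over (poly_ring R x V)"
proof (intro equalityI)
  show "poly_ring R x (insert k V) \<subseteq> (\<lambda>p. poly p (x k)) ` polys_over (poly_ring R x V)"
    by (intro poly_ring_least is_subring_poly_image is_subring_poly_ring)
       (auto intro: var_in_poly_image coeff_in_poly_image[OF is_subring_poly_ring]
         is_subring_poly_ring coeff_in_poly_ring var_in_poly_ring)
  have "poly p (x k) \<in> poly_ring R x (insert k V)" if "p \<in> polys_over (poly_ring R x V)" for p
    using that by (intro poly_in_subring[of "poly_ring R x V"] is_subring_poly_ring
        var_in_poly_ring poly_ring_mono) auto
  then show "(\<lambda>p. poly p (x k)) ` polys_over (poly_ring R x V) \<subseteq> poly_ring R x (insert k V)"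
    by blast
qed

section \<open>Polynomials over GCD domains\<close>

definition dvd_within :: "'a::idom set \<Rightarrow> 'a \<Rightarrow> 'a \<Rightarrow> bool" where
  "dvd_within A a b \<longleftrightarrow> (\<exists>c\<in>A. b = a * c)"

text \<open>Divisibility is relative to a carrier, because the rings of interest are subsets of one field.
  The condition on the cofactors is Euclid's lemma for \<open>b'\<close> and \<open>a'\<close>: it is what coprimality means
  in a GCD domain, and asking for it directly avoids any choice of normalized gcds.\<close>

definition has_gcd :: "'a::idom set \<Rightarrow> 'a \<Rightarrow> 'a \<Rightarrow> bool" where
  "has_gcd A a b \<longleftrightarrow> (\<exists>g\<in>A. \<exists>a'\<in>A. \<exists>b'\<in>A. a = g * a' \<and> b = g * b' \<and>
     (\<forall>h\<in>A. dvd_within A b' (a' * h) \<longrightarrow> dvd_within A b' h))"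

definition gcd_subring :: "'a::idom set \<Rightarrow> bool" where
  "gcd_subring A \<longleftrightarrow> (\<forall>a\<in>A. \<forall>b\<in>A. b \<noteq> 0 \<longrightarrow> has_gcd A a b)"

text \<open>For coefficients in a GCD domain this says that the content of \<open>p\<close> is a unit, in a form that can be
  applied to a divisor of all the multiples \<open>coeff p i * h\<close>.\<close>

definition primitive_over :: "'a::field set \<Rightarrow> 'a poly \<Rightarrow> bool" where
  "primitive_over A p \<longleftrightarrow> (\<forall>a\<in>A. \<forall>h\<in>A. a \<noteq> 0 \<longrightarrow>
     (\<forall>i. dvd_within A a (coeff p i * h)) \<longrightarrow> dvd_within A a h)"

lemma has_gcdI:
  assumes "g \<in> A" "a' \<in> A" "b' \<in> A" "a = g * a'" "b = g * b'"
    "\<And>h. h \<in> A \<Longrightarrow> dvd_within A b' (a' * h) \<Longrightarrow> dvd_within A b' h"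
  shows "has_gcd A a b"
  using assms unfolding has_gcd_def by blast

lemma gcd_subringE:
  assumes "gcd_subring A" "a \<in> A" "b \<in> A" "b \<noteq> 0"
  obtains g a' b' where "g \<in> A" "a' \<in> A" "b' \<in> A" "a = g * a'" "b = g * b'"
    "\<And>h. h \<in> A \<Longrightarrow> dvd_within A b' (a' * h) \<Longrightarrow> dvd_within A b' h"
proof -
  have "has_gcd A a b" using assms by (simp add: gcd_subring_def)
  then show ?thesis unfolding has_gcd_def using that by blast
qed

lemma primitive_overD:
  "primitive_over A p \<Longrightarrow> a \<in> A \<Longrightarrow> h \<in> A \<Longrightarrow> a \<noteq> 0 \<Longrightarrow>
    (\<And>i. dvd_within A a (coeff p i * h)) \<Longrightarrow> dvd_within A a h"
  by (auto simp: primitive_over_def)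

lemma dvd_within_0: "is_subring A \<Longrightarrow> dvd_within A a 0"
  by (auto simp: dvd_within_def intro: bexI[of _ 0] subring_0)

lemma dvd_within_mult_right:
  "is_subring A \<Longrightarrow> dvd_within A a b \<Longrightarrow> c \<in> A \<Longrightarrow> dvd_within A a (b * c)"
  unfolding dvd_within_def by (metis mult.assoc subring_mult)

lemma dvd_within_diff:
  "is_subring A \<Longrightarrow> dvd_within A a b \<Longrightarrow> dvd_within A a c \<Longrightarrow> dvd_within A a (b - c)"
  unfolding dvd_within_def by (metis right_diff_distrib subring_diff)

lemma dvd_within_sum:
  "is_subring A \<Longrightarrow> (\<And>i. i \<in> I \<Longrightarrow> dvd_within A a (f i)) \<Longrightarrow> dvd_within A a (sum f I)"
proof (induction I rule: infinite_finite_induct)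
  case (insert i I)
  then have "dvd_within A a (f i)" "dvd_within A a (sum f I)" by auto
  then have "dvd_within A a (f i + sum f I)"
    using insert.prems unfolding dvd_within_def by (metis distrib_left subring_add)
  then show ?case using insert by simp
qed (auto intro: dvd_within_0)

context
  fixes A :: "'a::field set"
  assumes A: "is_subring A"
begin

lemma const_dvd_polyE:
  assumes a: "a \<noteq> 0" and dvd: "\<And>i. dvd_within A a (coeff r i)"
  obtains q where "q \<in> polys_over A" "r = smult a q"
proof
  have "inverse a * coeff r i \<in> A" for i
  proof -
    obtain c where "c \<in> A" "coeff r i = a * c" using dvd[of i] by (auto simp: dvd_within_def)
    then show ?thesis using a by (simp flip: mult.assoc)
  qed
  then show "smult (inverse a) r \<in> polys_over A" by (simp add: polys_over_def)
  show "r = smult a (smult (inverse a) r)" using a by simp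
qed

text \<open>Induction on the coefficient list: for \<open>a + t c q\<close> with \<open>q\<close> primitive, split off
  the gcd of \<open>a\<close> and \<open>c\<close>.\<close>

lemma primitive_decomposition:
  assumes G: "gcd_subring A" and p: "p \<in> polys_over A" "p \<noteq> 0"
  obtains c q where "c \<in> A" "c \<noteq> 0" "q \<in> polys_over A" "p = smult c q" "primitive_over A q"
  using p
proof (induction p arbitrary: thesis)
  case (pCons a p)
  have aA: "a \<in> A" and pA: "p \<in> polys_over A" using pCons.prems by (auto simp: polys_over_pCons[OF A])
  show ?case
  proof (cases "p = 0")
    case True
    show ?thesis
    proof (rule pCons.prems(1))
      show "primitive_over A [:1:]"
        unfolding primitive_over_def by (metis coeff_pCons_0 mult_1)
    qed (use True aA pCons.hyps A in \<open>auto simp: polys_over_pCons polys_over_0 subring_1\<close>)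
  next
    case False
    then obtain c q where c: "c \<in> A" "c \<noteq> 0" and q: "q \<in> polys_over A" "p = smult c q"
      and prim: "primitive_over A q"
      using pCons.IH pA by blast
    obtain g a' c' where g: "g \<in> A" "a' \<in> A" "c' \<in> A" "a = g * a'" "c = g * c'"
      and cop: "\<And>h. h \<in> A \<Longrightarrow> dvd_within A c' (a' * h) \<Longrightarrow> dvd_within A c' h"
      using gcd_subringE[OF G aA c] by blast
    have c'0: "c' \<noteq> 0" and g0: "g \<noteq> 0" using g c by auto
    show ?thesis
    proof (rule pCons.prems(1)[of g "pCons a' (smult c' q)"])
      show "primitive_over A (pCons a' (smult c' q))"
        unfolding primitive_over_def
      proof (intro ballI impI)
        fix b h assume b: "b \<in> A" "b \<noteq> 0" and h: "h \<in> A"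
          and dvd: "\<forall>i. dvd_within A b (coeff (pCons a' (smult c' q)) i * h)"
        have 1: "dvd_within A b (a' * h)" using dvd[rule_format, of 0] by simp
        have 2: "dvd_within A b (c' * h)"
        proof (rule primitive_overD[OF prim])
          show "dvd_within A b (coeff q i * (c' * h))" for i
            using dvd[rule_format, of "Suc i"] by (simp add: mult_ac)
        qed (use b h g A in \<open>auto intro: subring_mult\<close>)
        from 1 2 obtain k l where kl: "k \<in> A" "l \<in> A" "a' * h = b * k" "c' * h = b * l"
          by (auto simp: dvd_within_def)
        have "b * (a' * l) = b * (c' * k)"
          using kl by (metis mult.assoc mult.commute)
        then have "a' * l = c' * k" using b by simp
        then have "dvd_within A c' l" using cop kl by (auto simp: dvd_within_def)
        then obtain e where e: "e \<in> A" "l = c' * e" by (auto simp: dvd_within_def)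
        have "c' * h = c' * (b * e)" using kl e by simp
        then have "h = b * e" using c'0 by simp
        with e show "dvd_within A b h" by (auto simp: dvd_within_def)
      qed
    qed (use g g0 q A in \<open>auto simp: polys_over_pCons polys_over_smult\<close>)
  qed
qed simp

text \<open>A proof of Gauss's lemma that does not use primes. Let \<open>a\<close> divide \<open>p r\<close>, let
  \<open>d\<close> be the gcd of \<open>a\<close> and the constant coefficient of \<open>p\<close>, and \<open>a = d a'\<close>. Comparing constant
  coefficients, \<open>a'\<close> divides the constant coefficient of \<open>r\<close>, and by induction on \<open>r\<close> it divides the
  remaining ones; write \<open>r = a' s\<close>. Then \<open>d\<close> divides \<open>p s\<close> and the constant
  coefficient of \<open>p\<close>, and by induction on the degree of \<open>p\<close>, applied to the primitive part of the
  rest of \<open>p\<close>, it divides every product of a coefficient of \<open>p\<close> and one of \<open>s\<close>. As \<open>p\<close> is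
  primitive, \<open>d\<close> divides \<open>s\<close>.\<close>

lemma gauss_lemma:
  assumes G: "gcd_subring A"
  shows "p \<in> polys_over A \<Longrightarrow> primitive_over A p \<Longrightarrow> r \<in> polys_over A \<Longrightarrow> a \<in> A \<Longrightarrow> a \<noteq> 0 \<Longrightarrow>
    (\<And>i. dvd_within A a (coeff (p * r) i)) \<Longrightarrow> dvd_within A a (coeff r i)"
proof (induction "degree p" arbitrary: p r a i rule: less_induct)
  case (less p)
  note outer = less.hyps and p = less.prems(1,2)
  have p0A: "coeff p 0 \<in> A" using p by (simp add: coeff_polys_over[OF A])
  show ?case using less.prems(3-6)
  proof (induction r arbitrary: a i)
    case 0
    then show ?case by (simp add: dvd_within_0 A)
  next
    case (pCons r0 r)
    have r0A: "r0 \<in> A" and rA: "r \<in> polys_over A"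
      using pCons.prems by (auto simp: polys_over_pCons[OF A])
    obtain d p0' a' where d: "d \<in> A" "p0' \<in> A" "a' \<in> A" "coeff p 0 = d * p0'" "a = d * a'"
      and cop: "\<And>h. h \<in> A \<Longrightarrow> dvd_within A a' (p0' * h) \<Longrightarrow> dvd_within A a' h"
      using gcd_subringE[OF G p0A pCons.prems(2,3)] by blast
    have nz: "d \<noteq> 0" "a' \<noteq> 0" using d pCons.prems by auto
    have "dvd_within A a (coeff p 0 * r0)"
      using pCons.prems(4)[of 0] by (simp add: coeff_mult mult.commute)
    then have "dvd_within A a' (p0' * r0)"
      using d nz by (auto simp: dvd_within_def mult.assoc)
    then have r0: "dvd_within A a' r0" using cop r0A by blast
    have a'_prod: "dvd_within A a' (coeff (p * pCons r0 r) j)" for j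
      using pCons.prems(4)[of j] d A unfolding dvd_within_def
      by (metis mult.assoc mult.commute subring_mult)
    have "dvd_within A a' (coeff (p * r) j)" for j
    proof -
      have "coeff (p * r) j = coeff (p * pCons r0 r) (Suc j) - r0 * coeff p (Suc j)"
        by (simp add: mult_pCons_right)
      also have "dvd_within A a' \<dots>"
        by (intro dvd_within_diff A a'_prod dvd_within_mult_right r0 coeff_polys_over p)
      finally show ?thesis .
    qed
    then have "dvd_within A a' (coeff r j)" for j
      using pCons.IH[OF rA] d nz by blast
    with r0 have "dvd_within A a' (coeff (pCons r0 r) j)" for j
      by (cases j) auto
    then obtain s where s: "s \<in> polys_over A" "pCons r0 r = smult a' s"
      using const_dvd_polyE nz by blast
    have d_ps: "dvd_within A d (coeff (p * s) j)" for j
    proof -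
      obtain e where "e \<in> A" "a' * coeff (p * s) j = a * e"
        using pCons.prems(4)[of j] s by (auto simp: dvd_within_def)
      then have "e \<in> A" "coeff (p * s) j = d * e" using nz d by (auto simp: mult_ac)
      then show ?thesis by (auto simp: dvd_within_def)
    qed
    have d_p0: "dvd_within A d (coeff p 0)" using d by (auto simp: dvd_within_def)
    obtain p0 p' where pp: "p = pCons p0 p'" by (cases p) auto
    have p'A: "p' \<in> polys_over A" using p pp by (auto simp: polys_over_pCons[OF A])
    have "dvd_within A d (coeff p k * coeff s j)" for j k
    proof (cases "p' = 0 \<or> k = 0")
      case True
      then show ?thesis using d_p0 pp s A
        by (cases k) (auto simp: dvd_within_0 intro!: dvd_within_mult_right coeff_polys_over)
    next
      case False
      obtain e q where e: "e \<in> A" "e \<noteq> 0" and q: "q \<in> polys_over A" "p' = smult e q"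
        "primitive_over A q"
        using primitive_decomposition[OF G p'A] False by blast
      have "dvd_within A d (coeff (smult e s) j)"
      proof (rule outer)
        show "degree q < degree p" using pp q False e by simp
        show "dvd_within A d (coeff (q * smult e s) i)" for i
        proof -
          have "coeff (q * smult e s) i = coeff (p * s) (Suc i) - p0 * coeff s (Suc i)"
            using pp q by simp
          also have "dvd_within A d \<dots>"
            using d_p0 pp s by (intro dvd_within_diff A d_ps dvd_within_mult_right coeff_polys_over) auto
          finally show ?thesis .
        qed
      qed (use q(1,3) s(1) e d(1) nz(1) polys_over_smult[OF A] in simp_all)
      then have "dvd_within A d (e * coeff s j * coeff q (k - 1))"
        using A q(1) dvd_within_mult_right coeff_polys_over by fastforce
      moreover have "coeff p k = e * coeff q (k - 1)"
        using False q(2) unfolding pp by (cases k) simp_all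
      ultimately show ?thesis by (simp add: mult_ac)
    qed
    then have "dvd_within A d (coeff s j)" for j
      using d(1) nz(1) coeff_polys_over[OF A s(1)] by (metis primitive_overD[OF p(2)])
    then obtain e where e: "e \<in> A" "coeff s i = d * e" by (auto simp: dvd_within_def)
    have "coeff (pCons r0 r) i = a' * coeff s i" by (simp only: s(2) coeff_smult)
    with e d(5) have "e \<in> A" "coeff (pCons r0 r) i = a * e" by simp_all
    then show ?case unfolding dvd_within_def by blast
  qed
qed

lemma pseudo_division:
  assumes d: "d \<in> polys_over A" "d \<noteq> 0"
  shows "p \<in> polys_over A \<Longrightarrow> \<exists>a\<in>A. a \<noteq> 0 \<and> (\<exists>q\<in>polys_over A.
    smult a p - q * d = 0 \<or> degree (smult a p - q * d) < degree d)"
proof (induction "degree p" arbitrary: p rule: less_induct)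
  case less
  show ?case
  proof (cases "p = 0 \<or> degree p < degree d")
    case True
    then have "smult 1 p - 0 * d = 0 \<or> degree (smult 1 p - 0 * d) < degree d" by auto
    with subring_1[OF A] polys_over_0[OF A] show ?thesis by (metis zero_neq_one)
  next
    case False
    define l where "l = lead_coeff d"
    define t where "t = monom (lead_coeff p) (degree p - degree d)"
    define p2 where "p2 = smult l p - t * d"
    have l: "l \<in> A" "l \<noteq> 0" using d A by (auto simp: l_def coeff_polys_over)
    have tA: "t \<in> polys_over A" using less.prems A by (auto simp: t_def polys_over_monom coeff_polys_over)
    have p2A: "p2 \<in> polys_over A" unfolding p2_def
      using less.prems d tA l A by (intro polys_over_diff polys_over_mult polys_over_smult)
    have "coeff p2 (degree p) = l * lead_coeff p - lead_coeff p * coeff d (degree d)"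
      using False by (simp add: p2_def t_def coeff_monom_mult)
    then have top: "coeff p2 (degree p) = 0" by (simp add: l_def)
    have "degree (t * d) \<le> degree p"
      using False d by (simp add: t_def degree_mult_eq degree_monom_eq)
    then have "degree p2 \<le> degree p" unfolding p2_def by (intro degree_diff_le) (auto simp: l)
    then consider "p2 = 0" | "degree p2 < degree p"
      using top by (metis le_neq_implies_less leading_coeff_0_iff)
    then show ?thesis
    proof cases
      case 1
      with l tA show ?thesis unfolding p2_def by blast
    next
      case 2
      from less.hyps[OF this p2A] obtain a q where aq: "a \<in> A" "a \<noteq> 0" "q \<in> polys_over A"
        "smult a p2 - q * d = 0 \<or> degree (smult a p2 - q * d) < degree d" by blast
      have eq: "smult (a * l) p - (smult a t + q) * d = smult a p2 - q * d"
        by (simp add: p2_def algebra_simps smult_diff_right)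
      have "a * l \<in> A" "a * l \<noteq> 0" "smult a t + q \<in> polys_over A"
        using aq l tA A by (auto intro: subring_mult polys_over_add polys_over_smult)
      with aq(4) show ?thesis unfolding eq[symmetric] by blast
    qed
  qed
qed

text \<open>A nonzero combination \<open>d = u p + v q\<close> of least degree divides a constant multiple of every other
  combination, by pseudo-division. By Gauss's lemma its primitive part \<open>d\<^sub>1\<close> divides \<open>p\<close> and
  \<open>q\<close>, and the quotients have a combination that is a constant \<open>c\<close>. So \<open>d\<^sub>1\<close> times the gcd of the contents
  of the quotients is the gcd sought. Euclid's lemma for the cofactors is proved first for
  the contents, in the ground ring, and then for the primitive parts, where the relation with
  value \<open>c\<close> gives divisibility up to a constant and Gauss's lemma removes the constant.\<close>

lemma gcd_subring_polys_over:
  assumes G: "gcd_subring A"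
  shows "gcd_subring (polys_over A)"
  unfolding gcd_subring_def
proof (intro ballI impI)
  fix p q assume p: "p \<in> polys_over A" and q: "q \<in> polys_over A" "q \<noteq> 0"
  let ?P = "polys_over A"
  show "has_gcd ?P p q"
  proof (cases "p = 0")
    case True
    have "p = q * 0" "q = q * 1" using True by simp_all
    then show ?thesis using q polys_over_0[OF A] polys_over_1[OF A]
      by (intro has_gcdI[of q _ 0 1]) (simp_all add: dvd_within_def)
  next
    case False
    \<comment> \<open>a nonzero remainder of a pseudo-division of \<open>p\<close> or \<open>q\<close> by such a combination is
    again one, which is why a combination of least degree divides both up to constants\<close>
    define comb where "comb = {d. d \<noteq> 0 \<and> (\<exists>u\<in>?P. \<exists>v\<in>?P. d = u * p + v * q)}"
    have "q = 0 * p + 1 * q" by simp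
    then have "q \<in> comb"
      using q polys_over_0[OF A] polys_over_1[OF A] unfolding comb_def by blast
    then obtain d where d: "d \<in> comb" and min: "\<And>e. e \<in> comb \<Longrightarrow> degree d \<le> degree e"
      using ex_has_least_nat[of "\<lambda>e. e \<in> comb" q degree] by blast
    from d obtain u v where uv: "u \<in> ?P" "v \<in> ?P" "d = u * p + v * q" and d0: "d \<noteq> 0"
      by (auto simp: comb_def)
    have dA: "d \<in> ?P" using uv p q A by (auto intro: polys_over_add polys_over_mult)
    obtain c d1 where c: "c \<in> A" "c \<noteq> 0" and d1: "d1 \<in> ?P" "d = smult c d1" "primitive_over A d1"
      using primitive_decomposition[OF G dA d0] by blast
    have d1_dvd: "\<exists>f'\<in>?P. f = d1 * f'"
      if f: "f \<in> ?P" and comb_f: "\<And>a w. a \<in> A \<Longrightarrow> w \<in> ?P \<Longrightarrow> smult a f - w * d \<noteq> 0 \<Longrightarrow> smult a f - w * d \<in> comb" for f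
    proof -
      obtain a w where aw: "a \<in> A" "a \<noteq> 0" "w \<in> ?P"
        "smult a f - w * d = 0 \<or> degree (smult a f - w * d) < degree d"
        using pseudo_division[OF dA d0 f] by blast
      then have "smult a f - w * d = 0" using comb_f min by (meson linorder_not_less)
      then have eq: "d1 * smult c w = smult a f" using d1 by (simp add: mult_ac)
      have "dvd_within A a (coeff (smult c w) i)" for i
      proof (rule gauss_lemma[OF G d1(1,3)])
        show "dvd_within A a (coeff (d1 * smult c w) j)" for j
          unfolding eq dvd_within_def using f A by (auto intro: coeff_polys_over)
      qed (use c aw polys_over_smult[OF A] in auto)
      then obtain f' where f': "f' \<in> ?P" "smult c w = smult a f'"
        using const_dvd_polyE aw by blast
      have "smult a f = smult a (d1 * f')" using eq f' by simp
      then have "f = d1 * f'" using aw by (metis smult_cancel)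
      with f' show ?thesis by blast
    qed
    have combI: "u * p + v * q \<in> comb" if "u * p + v * q \<noteq> 0" "u \<in> ?P" "v \<in> ?P" for u v
      using that unfolding comb_def by blast
    have const: "[:a:] \<in> ?P" if "a \<in> A" for a
      using that by (simp add: polys_over_pCons[OF A] polys_over_0[OF A])
    have wP: "w * u \<in> ?P" "w * v \<in> ?P" "0 - w * u \<in> ?P" "0 - w * v \<in> ?P" if "w \<in> ?P" for w
      using that uv(1,2) by (simp_all only: polys_over_mult[OF A] polys_over_diff[OF A] polys_over_0[OF A])
    have "\<exists>f'\<in>?P. p = d1 * f'"
    proof (rule d1_dvd[OF p])
      fix a w assume aw: "a \<in> A" "w \<in> ?P" "smult a p - w * d \<noteq> 0"
      have eq: "smult a p - w * d = ([:a:] - w * u) * p + (0 - w * v) * q"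
        by (simp add: uv(3) algebra_simps)
      show "smult a p - w * d \<in> comb"
        using aw(3) unfolding eq
        by (rule combI) (simp_all only: const aw wP polys_over_diff[OF A])
    qed
    moreover have "\<exists>f'\<in>?P. q = d1 * f'"
    proof (rule d1_dvd[OF q(1)])
      fix a w assume aw: "a \<in> A" "w \<in> ?P" "smult a q - w * d \<noteq> 0"
      have eq: "smult a q - w * d = (0 - w * u) * p + ([:a:] - w * v) * q"
        by (simp add: uv(3) algebra_simps)
      show "smult a q - w * d \<in> comb"
        using aw(3) unfolding eq
        by (rule combI) (simp_all only: const aw wP polys_over_diff[OF A])
    qed
    ultimately obtain p' q' where p': "p' \<in> ?P" "p = d1 * p'" and q': "q' \<in> ?P" "q = d1 * q'" by blast
    have nz: "d1 \<noteq> 0" "p' \<noteq> 0" "q' \<noteq> 0" using False q p' q' by auto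
    have "d1 * (u * p' + v * q') = d1 * [:c:]" using uv d1 p' q' by (simp add: algebra_simps)
    then have bez: "u * p' + v * q' = [:c:]" using nz by (metis mult_cancel_left)
    obtain a p2 where a: "a \<in> A" "a \<noteq> 0" and p2: "p2 \<in> ?P" "p' = smult a p2" "primitive_over A p2"
      using primitive_decomposition[OF G p'(1) nz(2)] by blast
    obtain b q2 where b: "b \<in> A" "b \<noteq> 0" and q2: "q2 \<in> ?P" "q' = smult b q2" "primitive_over A q2"
      using primitive_decomposition[OF G q'(1) nz(3)] by blast
    obtain g a' b' where g: "g \<in> A" "a' \<in> A" "b' \<in> A" "a = g * a'" "b = g * b'"
      and cop: "\<And>h. h \<in> A \<Longrightarrow> dvd_within A b' (a' * h) \<Longrightarrow> dvd_within A b' h"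
      using gcd_subringE[OF G a(1) b] by blast
    have gnz: "g \<noteq> 0" "a' \<noteq> 0" "b' \<noteq> 0" using g a b by auto
    have "dvd_within ?P (smult b' q2) h"
      if h: "h \<in> ?P" and dvd: "dvd_within ?P (smult b' q2) (smult a' p2 * h)" for h
    proof -
      obtain k where k: "k \<in> ?P" "smult a' p2 * h = smult b' q2 * k"
        using dvd by (auto simp: dvd_within_def)
      have eq: "p2 * smult a' h = smult b' (q2 * k)" using k by simp
      have "dvd_within A b' (coeff (smult a' h) i)" for i
      proof (rule gauss_lemma[OF G p2(1,3)])
        show "dvd_within A b' (coeff (p2 * smult a' h) j)" for j
          unfolding eq dvd_within_def
          using coeff_polys_over[OF A polys_over_mult[OF A q2(1) k(1)]] by auto
      qed (use g gnz h polys_over_smult[OF A] in auto)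
      then have "dvd_within A b' (coeff h i)" for i
        using cop[of "coeff h i"] h A by (simp add: coeff_polys_over)
      then obtain h1 where h1: "h1 \<in> ?P" "h = smult b' h1" using const_dvd_polyE gnz by blast
      have "smult b' (p2 * smult a' h1) = smult b' (q2 * k)" using eq h1 by (simp add: mult_ac)
      then have eq2: "p2 * smult a' h1 = q2 * k" using gnz by (metis smult_cancel)
      define K where "K = smult a u * k + smult b v * smult a' h1"
      have KA: "K \<in> ?P" unfolding K_def using a b uv k h1 g A
        by (intro polys_over_add polys_over_mult polys_over_smult)
      have "q2 * K = smult a u * (p2 * smult a' h1) + smult b v * q2 * smult a' h1"
        unfolding K_def eq2 by (simp add: algebra_simps)
      also have "\<dots> = (u * p' + v * q') * smult a' h1" using p2 q2 by (simp add: algebra_simps)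
      also have "\<dots> = smult (a' * c) h1" by (simp add: bez)
      also have "a' * c = c * a'" by (rule mult.commute)
      finally have eq3: "q2 * K = smult (c * a') h1" .
      have ca: "c * a' \<in> A" "c * a' \<noteq> 0" using c g gnz A by (auto intro: subring_mult)
      have "dvd_within A (c * a') (coeff K i)" for i
      proof (rule gauss_lemma[OF G q2(1,3) KA ca])
        show "dvd_within A (c * a') (coeff (q2 * K) j)" for j
          unfolding eq3 dvd_within_def using coeff_polys_over[OF A h1(1)] by auto
      qed
      then obtain K' where K': "K' \<in> ?P" "K = smult (c * a') K'" using const_dvd_polyE ca by blast
      have "smult (c * a') h1 = smult (c * a') (q2 * K')" using eq3 K' by simp
      then have "h1 = q2 * K'" using ca by (metis smult_cancel)
      then have "h = smult b' q2 * K'" using h1 by simp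
      with K' show ?thesis by (auto simp: dvd_within_def)
    qed
    moreover have "p = smult g d1 * smult a' p2" "q = smult g d1 * smult b' q2"
      using p' q' p2 q2 g by (simp_all add: mult_ac)
    moreover have "smult g d1 \<in> ?P" "smult a' p2 \<in> ?P" "smult b' q2 \<in> ?P"
      using g d1 p2 q2 A by (auto intro: polys_over_smult)
    ultimately show ?thesis by (metis has_gcdI)
  qed
qed

lemma gcd_subring_poly_image:
  assumes G: "gcd_subring A" and t: "transcendental_over A t"
  shows "gcd_subring ((\<lambda>p. poly p t) ` polys_over A)" (is "gcd_subring ?B")
  unfolding gcd_subring_def
proof (intro ballI impI)
  have inj: "p = q" if "poly p t = poly q t" "p \<in> polys_over A" "q \<in> polys_over A" for p q
  proof -
    have "poly (p - q) t = 0" "p - q \<in> polys_over A" using that A by (auto intro: polys_over_diff)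
    then have "p - q = 0" using t unfolding transcendental_over_def by blast
    then show ?thesis by simp
  qed
  have dvd_iff: "dvd_within ?B (poly p t) (poly q t) \<longleftrightarrow> dvd_within (polys_over A) p q"
    if p: "p \<in> polys_over A" and q: "q \<in> polys_over A" for p q
  proof
    assume "dvd_within ?B (poly p t) (poly q t)"
    then obtain r where r: "r \<in> polys_over A" "poly q t = poly (p * r) t"
      by (auto simp: dvd_within_def)
    then have "q = p * r" using p q A by (intro inj) (auto intro: polys_over_mult)
    then show "dvd_within (polys_over A) p q" using r by (auto simp: dvd_within_def)
  qed (auto simp: dvd_within_def)
  fix a b assume "a \<in> ?B" "b \<in> ?B" "b \<noteq> 0"
  then obtain p q where pq: "p \<in> polys_over A" "q \<in> polys_over A" "a = poly p t" "b = poly q t" "q \<noteq> 0"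
    by (elim imageE) (metis poly_0)
  obtain g p' q' where g: "g \<in> polys_over A" "p' \<in> polys_over A" "q' \<in> polys_over A"
    "p = g * p'" "q = g * q'"
    and cop: "\<And>h. h \<in> polys_over A \<Longrightarrow> dvd_within (polys_over A) q' (p' * h) \<Longrightarrow>
      dvd_within (polys_over A) q' h"
    using gcd_subringE[OF gcd_subring_polys_over[OF G] pq(1,2,5)] by blast
  have "dvd_within ?B (poly q' t) h" if h: "h \<in> ?B" and dvd: "dvd_within ?B (poly q' t) (poly p' t * h)" for h
  proof -
    from h obtain r where r: "r \<in> polys_over A" "h = poly r t" by blast
    then have "dvd_within ?B (poly q' t) (poly (p' * r) t)" using dvd by simp
    then have "dvd_within (polys_over A) q' (p' * r)"
      using dvd_iff[OF g(3) polys_over_mult[OF A g(2) r(1)]] by blast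
    then show ?thesis using cop r dvd_iff g by blast
  qed
  moreover have "a = poly g t * poly p' t" "b = poly g t * poly q' t" using pq g by auto
  moreover have "poly g t \<in> ?B" "poly p' t \<in> ?B" "poly q' t \<in> ?B" using g by auto
  ultimately show "has_gcd ?B a b" by (metis has_gcdI)
qed

text \<open>Coprimality, defined by common divisors, implies Euclid's lemma: the gcd is then a
  unit, so Euclid's lemma for the cofactors carries over.\<close>

lemma coprime_in_gcd_subring:
  assumes G: "gcd_subring A" and f: "f \<in> A" and g: "g \<in> A" "g \<noteq> 0" and cop: "coprime_in A f g"
    and h: "h \<in> A" and dvd: "dvd_within A g (f * h)"
  shows "dvd_within A g h"
proof -
  obtain c f' g' where c: "c \<in> A" "f' \<in> A" "g' \<in> A" "f = c * f'" "g = c * g'"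
    and strong: "\<And>h. h \<in> A \<Longrightarrow> dvd_within A g' (f' * h) \<Longrightarrow> dvd_within A g' h"
    using gcd_subringE[OF G f g] by blast
  have "divides_in A c f" "divides_in A c g" using c by (auto simp: divides_in_def)
  then obtain e where e: "e \<in> A" "1 = c * e" using cop c by (auto simp: coprime_in_def divides_in_def)
  have c0: "c \<noteq> 0" using e by auto
  have "dvd_within A g' (f' * h)" using dvd c c0 by (auto simp: dvd_within_def mult.assoc)
  then obtain k where k: "k \<in> A" "h = g' * k" using strong h by (auto simp: dvd_within_def)
  have "h = (c * e) * (g' * k)" using k e by simp
  also have "\<dots> = g * (e * k)" using c by (simp add: mult_ac)
  finally show ?thesis using e k A by (auto simp: dvd_within_def intro: subring_mult)
qed

end

lemma gcd_subring_Ints: "gcd_subring (\<int> :: 'a::field_char_0 set)"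
  unfolding gcd_subring_def
proof (intro ballI impI)
  fix a b :: 'a assume "a \<in> \<int>" "b \<in> \<int>" "b \<noteq> 0"
  then obtain i j :: int where ij: "a = of_int i" "b = of_int j" "j \<noteq> 0" by (auto elim!: Ints_cases)
  have dvd_iff: "dvd_within \<int> (of_int k) (of_int l :: 'a) \<longleftrightarrow> k dvd l" for k l :: int
  proof
    assume "dvd_within \<int> (of_int k) (of_int l :: 'a)"
    then obtain z :: int where "of_int l = (of_int k * of_int z :: 'a)"
      by (auto simp: dvd_within_def elim!: Ints_cases)
    then have "l = k * z" by (metis of_int_eq_iff of_int_mult)
    then show "k dvd l" by simp
  qed (auto simp: dvd_within_def dvd_def)
  define g where "g = gcd i j"
  obtain i' j' where g: "i = g * i'" "j = g * j'" "coprime i' j'"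
    using gcd_coprime_exists[of i j] ij(3) unfolding g_def by (metis gcd_eq_0_iff mult.commute)
  have "dvd_within \<int> (of_int j') h" if "h \<in> \<int>" "dvd_within \<int> (of_int j') (of_int i' * h)" for h :: 'a
  proof -
    from that obtain l :: int where l: "h = of_int l" by (auto elim!: Ints_cases)
    have "j' dvd i' * l" using that(2) dvd_iff[of j' "i' * l"] by (simp add: l)
    then have "j' dvd l" using g(3) by (simp add: coprime_commute coprime_dvd_mult_right_iff)
    then show ?thesis using dvd_iff l by simp
  qed
  moreover have "a = of_int g * of_int i'" "b = of_int g * of_int j'"
    using ij(1,2) g(1,2) by (metis of_int_mult)+
  ultimately show "has_gcd \<int> a b" by (metis has_gcdI Ints_of_int)
qed

lemma gcd_subring_subfield:
  assumes "is_subfield R" shows "gcd_subring R"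
  unfolding gcd_subring_def
proof (intro ballI impI)
  fix a b assume ab: "a \<in> R" "b \<in> R" "b \<noteq> 0"
  have R: "is_subring R" "inverse b \<in> R" using assms ab by (auto simp: is_subfield_def)
  have "a = b * (a * inverse b)" using ab by simp
  moreover have "a * inverse b \<in> R" using R ab by (auto intro: subring_mult)
  ultimately show "has_gcd R a b"
    using ab R(1) by (intro has_gcdI[of b _ "a * inverse b" 1]) (auto simp: dvd_within_def subring_1)
qed

section \<open>Algebraic independence, one variable at a time\<close>

definition pm_monomial :: "(nat \<Rightarrow> 'a::field) \<Rightarrow> (nat \<Rightarrow>\<^sub>0 nat) \<Rightarrow> 'a" where
  "pm_monomial x e = (\<Prod>k\<in>Poly_Mapping.keys e. x k ^ Poly_Mapping.lookup e k)"

lemma pm_monomial_superset: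
  assumes "finite W" "Poly_Mapping.keys e \<subseteq> W"
  shows "pm_monomial x e = (\<Prod>k\<in>W. x k ^ Poly_Mapping.lookup e k)"
  unfolding pm_monomial_def using assms
  by (intro prod.mono_neutral_left) (auto simp: in_keys_iff)

lemma pm_monomial_add: "pm_monomial x (e + e') = pm_monomial x e * pm_monomial x e'"
proof -
  have "finite (Poly_Mapping.keys e \<union> Poly_Mapping.keys e')" by simp
  then show ?thesis
    using keys_add[of e e']
    by (simp add: pm_monomial_superset[of "Poly_Mapping.keys e \<union> Poly_Mapping.keys e'"]
        lookup_add power_add prod.distrib)
qed

lemma pm_monomial_single: "pm_monomial x (Poly_Mapping.single k j) = x k ^ j"
  by (cases "j = 0") (simp_all add: pm_monomial_def)

lemma pm_monomial_in_poly_ring: "Poly_Mapping.keys e \<subseteq> V \<Longrightarrow> pm_monomial x e \<in> poly_ring R x V"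
  unfolding pm_monomial_def
  by (intro subring_prod subring_power is_subring_poly_ring var_in_poly_ring) auto

text \<open>Linear independence of monomials for sums over an arbitrary finite index set, which avoids
  collecting a sum into a polynomial each time.\<close>

lemma alg_independentD_family:
  assumes ind: "alg_independent R x V" and R: "0 \<in> R" and I: "finite I" and inj: "inj_on ex I"
    and ex: "\<And>i. i \<in> I \<Longrightarrow> Poly_Mapping.keys (ex i) \<subseteq> V" and c: "\<And>i. i \<in> I \<Longrightarrow> c i \<in> R"
    and sum0: "(\<Sum>i\<in>I. c i * pm_monomial x (ex i)) = 0"
    and i: "i \<in> I"
  shows "c i = 0"
proof -
  define c' where "c' e = (if e \<in> ex ` I then c (the_inv_into I ex e) else 0)" for e
  have c'_ex: "c' (ex k) = c k" if "k \<in> I" for k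
    using that inj by (simp add: c'_def the_inv_into_f_f)
  define p where "p = Abs_poly_mapping c'"
  have "finite {e. c' e \<noteq> 0}"
    by (rule finite_subset[of _ "ex ` I"]) (use I in \<open>auto simp: c'_def split: if_splits\<close>)
  then have lookup: "Poly_Mapping.lookup p = c'" by (simp add: p_def)
  have keys: "Poly_Mapping.keys p \<subseteq> ex ` I"
    by (auto simp: keys.rep_eq lookup c'_def split: if_splits)
  have "mpoly_eval x p = (\<Sum>e\<in>Poly_Mapping.keys p. c' e * pm_monomial x e)"
    by (simp add: mpoly_eval_def lookup pm_monomial_def)
  also have "\<dots> = (\<Sum>e\<in>ex ` I. c' e * pm_monomial x e)"
    using I keys by (intro sum.mono_neutral_left) (auto simp: in_keys_iff lookup)
  also have "\<dots> = (\<Sum>i\<in>I. c i * pm_monomial x (ex i))"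
    using inj c'_ex by (simp add: sum.reindex)
  finally have "mpoly_eval x p = 0" using sum0 by simp
  moreover have "p \<in> mpolys R V"
    using keys ex c c'_ex by (force simp: mpolys_def lookup)
  ultimately have "p = 0" using ind by (auto simp: alg_independent_def)
  then show ?thesis using c'_ex[OF i] lookup by (metis lookup_zero)
qed

lemma alg_independent_mono: "alg_independent R x V \<Longrightarrow> W \<subseteq> V \<Longrightarrow> alg_independent R x W"
  unfolding alg_independent_def mpolys_def by blast

lemma alg_independent_cong:
  assumes "\<And>k. k \<in> V \<Longrightarrow> x k = y k"
  shows "alg_independent R x V = alg_independent R y V"
proof -
  have "mpoly_eval x p = mpoly_eval y p" if "p \<in> mpolys R V" for p
    unfolding mpoly_eval_def
    by (intro sum.cong refl arg_cong2[of _ _ _ _ "(*)"] prod.cong)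
      (use that assms in \<open>auto simp: mpolys_def subset_iff\<close>)
  then show ?thesis by (simp add: alg_independent_def)
qed

lemma poly_ring_empty: "is_subring R \<Longrightarrow> poly_ring R x {} = R"
  by (simp add: poly_ring_def hull_same)

definition monomial_sum :: "'a::field set \<Rightarrow> (nat \<Rightarrow> 'a) \<Rightarrow> nat set \<Rightarrow> 'a \<Rightarrow>
    (nat \<Rightarrow>\<^sub>0 nat) set \<Rightarrow> ((nat \<Rightarrow>\<^sub>0 nat) \<Rightarrow> 'a) \<Rightarrow> bool" where
  "monomial_sum R x V a E c \<longleftrightarrow> finite E \<and> (\<forall>e\<in>E. Poly_Mapping.keys e \<subseteq> V \<and> c e \<in> R) \<and>
     a = (\<Sum>e\<in>E. c e * pm_monomial x e)"

lemma inj_on_add_single: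
  fixes E :: "nat \<Rightarrow> (nat \<Rightarrow>\<^sub>0 nat) set"
  assumes "\<And>j e. j \<in> J \<Longrightarrow> e \<in> E j \<Longrightarrow> Poly_Mapping.keys e \<subseteq> V" "k \<notin> V"
  shows "inj_on (\<lambda>(j, e). e + Poly_Mapping.single k j) (Sigma J E)"
proof (rule inj_onI, clarify)
  fix i e j e' assume *: "i \<in> J" "e \<in> E i" "j \<in> J" "e' \<in> E j"
    "e + Poly_Mapping.single k i = e' + Poly_Mapping.single k j"
  have "Poly_Mapping.lookup e k = 0" "Poly_Mapping.lookup e' k = 0"
    using assms * by (auto simp flip: not_in_keys_iff_lookup_eq_zero)
  then have "i = j" using arg_cong[OF *(5), of "\<lambda>p. Poly_Mapping.lookup p k"]
    by (simp add: lookup_add)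
  moreover from this have "e = e'" using *(5) by simp
  ultimately show "i = j \<and> e = e'" by simp
qed

text \<open>The exponents \<open>e + single k j\<close> are distinct for distinct pairs \<open>(j, e)\<close> with \<open>k\<close> not in the support
  of \<open>e\<close>, so expanding every coefficient of \<open>p\<close> into monomials gives an expansion
  of the value of \<open>p\<close> without collisions.\<close>

lemma poly_value_monomial_sum:
  assumes k: "k \<notin> V" and Ec: "\<And>j. monomial_sum R x V (coeff p j) (E j) (c j)"
  defines "ex \<equiv> \<lambda>(j, e). e + Poly_Mapping.single k j" and "I \<equiv> Sigma {..degree p} E"
  shows "finite I" "inj_on ex I" "\<And>i. i \<in> I \<Longrightarrow> Poly_Mapping.keys (ex i) \<subseteq> insert k V"
    "\<And>i. i \<in> I \<Longrightarrow> case_prod c i \<in> R"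
    "poly p (x k) = (\<Sum>i\<in>I. case_prod c i * pm_monomial x (ex i))"
proof -
  have fin: "finite (E j)" and coeff: "coeff p j = (\<Sum>e\<in>E j. c j e * pm_monomial x e)" for j
    using Ec by (auto simp: monomial_sum_def)
  have keys: "Poly_Mapping.keys e \<subseteq> V" and cR: "c j e \<in> R" if "e \<in> E j" for j e
    using Ec that unfolding monomial_sum_def by blast+
  show "finite I" by (auto simp: I_def fin)
  show "inj_on ex I" unfolding ex_def I_def
    by (rule inj_on_add_single[of _ _ V]) (use keys k in auto)
  show "Poly_Mapping.keys (ex i) \<subseteq> insert k V" if "i \<in> I" for i
    using that keys keys_add[of "snd i" "Poly_Mapping.single k (fst i)"]
    by (fastforce simp: ex_def I_def split: if_splits)
  show "case_prod c i \<in> R" if "i \<in> I" for i using that cR by (auto simp: I_def)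
  have "poly p (x k) = (\<Sum>j\<le>degree p. \<Sum>e\<in>E j. c j e * pm_monomial x (ex (j, e)))"
    unfolding poly_altdef coeff sum_distrib_right
    by (simp add: ex_def pm_monomial_add pm_monomial_single mult.assoc)
  also have "\<dots> = (\<Sum>i\<in>I. case_prod c i * pm_monomial x (ex i))"
    unfolding I_def by (subst sum.Sigma) (auto simp: fin split_def)
  finally show "poly p (x k) = \<dots>" .
qed

lemma poly_ring_monomial_sum:
  assumes R: "is_subring R" and V: "finite V"
  shows "a \<in> poly_ring R x V \<Longrightarrow> \<exists>E c. monomial_sum R x V a E c"
  using V
proof (induction V arbitrary: a)
  case empty
  then have "monomial_sum R x {} a {0} (\<lambda>_. a)"
    using R by (simp add: poly_ring_empty monomial_sum_def pm_monomial_def)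
  then show ?case by blast
next
  case (insert k V)
  then obtain p where p: "p \<in> polys_over (poly_ring R x V)" "a = poly p (x k)"
    by (auto simp: poly_ring_insert)
  have "\<forall>j. \<exists>E c. monomial_sum R x V (coeff p j) E c"
    using p insert.IH by (simp add: polys_over_def)
  then obtain E c where Ec: "\<And>j. monomial_sum R x V (coeff p j) (E j) (c j)" by metis
  define I where "I = Sigma {..degree p} E"
  define ex where "ex = (\<lambda>(j, e). e + Poly_Mapping.single k (j::nat))"
  note val = poly_value_monomial_sum[OF insert.hyps(2) Ec, folded I_def ex_def]
  have "a = (\<Sum>e\<in>ex ` I. case_prod c (the_inv_into I ex e) * pm_monomial x e)"
    unfolding p(2) val(5) by (subst sum.reindex[OF val(2)]) (simp add: the_inv_into_f_f[OF val(2)])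
  then have "monomial_sum R x (insert k V) a (ex ` I) (\<lambda>e. case_prod c (the_inv_into I ex e))"
    unfolding monomial_sum_def using val(1,3,4) by (auto simp: the_inv_into_f_f[OF val(2)])
  then show ?case by blast
qed

text \<open>This lemma and the next one reduce algebraic independence to transcendence
  of one variable over the polynomial ring in the others, in any order of the variables. This is
  needed because a mutation changes one variable, and a different one each time, while
  the arguments about divisibility concern polynomials in one variable.\<close>

lemma alg_independent_insert_imp:
  assumes R: "is_subring R" and V: "finite V" "k \<notin> V"
    and ind: "alg_independent R x (insert k V)"
  shows "transcendental_over (poly_ring R x V) (x k)"
  unfolding transcendental_over_def
proof (intro ballI impI)
  fix p assume p: "p \<in> polys_over (poly_ring R x V)" and root: "poly p (x k) = 0"
  have "\<forall>j. \<exists>E c. monomial_sum R x V (coeff p j) E c"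
    using p poly_ring_monomial_sum[OF R V(1)] by (simp add: polys_over_def)
  then obtain E c where Ec: "\<And>j. monomial_sum R x V (coeff p j) (E j) (c j)" by metis
  note val = poly_value_monomial_sum[OF V(2) Ec]
  have "c j e = 0" if "j \<le> degree p" "e \<in> E j" for j e
  proof -
    have "case_prod c (j, e) = 0"
      by (rule alg_independentD_family[OF ind subring_0[OF R] val(1-4)])
        (use that val(5) root in auto)
    then show ?thesis by simp
  qed
  moreover have "coeff p j = (\<Sum>e\<in>E j. c j e * pm_monomial x e)" for j
    using Ec by (simp add: monomial_sum_def)
  ultimately have "coeff p (degree p) = 0" by simp
  then show "p = 0" by simp
qed

lemma alg_independent_insertI:
  assumes R: "is_subring R" and V: "k \<notin> V"
    and ind: "alg_independent R x V" and t: "transcendental_over (poly_ring R x V) (x k)"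
  shows "alg_independent R x (insert k V)"
  unfolding alg_independent_def
proof (intro ballI impI)
  fix p assume p: "p \<in> mpolys R (insert k V)" and root: "mpoly_eval x p = 0"
  define E where "E = Poly_Mapping.keys p"
  define rest where "rest e = e - Poly_Mapping.single k (Poly_Mapping.lookup e k)" for e :: "nat \<Rightarrow>\<^sub>0 nat"
  have split: "e = rest e + Poly_Mapping.single k (Poly_Mapping.lookup e k)" for e
    by (rule poly_mapping_eqI) (simp add: rest_def lookup_add lookup_minus lookup_single when_def)
  have keys_rest: "Poly_Mapping.keys (rest e) \<subseteq> V" if "e \<in> E" for e
  proof
    fix l assume "l \<in> Poly_Mapping.keys (rest e)"
    then have "Poly_Mapping.lookup (rest e) l \<noteq> 0" by (simp add: in_keys_iff)
    then have "l \<noteq> k" "l \<in> Poly_Mapping.keys e"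
      by (auto simp: rest_def lookup_minus lookup_single when_def in_keys_iff split: if_splits)
    with that p show "l \<in> V" by (auto simp: mpolys_def E_def)
  qed
  have coeff_R: "Poly_Mapping.lookup p e \<in> R" if "e \<in> E" for e
    using that p by (auto simp: mpolys_def E_def)
  have mon: "pm_monomial x e = pm_monomial x (rest e) * x k ^ Poly_Mapping.lookup e k" for e
    by (subst split) (simp only: pm_monomial_add pm_monomial_single)
  define P where "P = (\<Sum>e\<in>E. monom (Poly_Mapping.lookup p e * pm_monomial x (rest e)) (Poly_Mapping.lookup e k))"
  have "mpoly_eval x p = (\<Sum>e\<in>E. Poly_Mapping.lookup p e * pm_monomial x e)"
    by (simp add: mpoly_eval_def E_def pm_monomial_def)
  also have "\<dots> = poly P (x k)"
    unfolding P_def poly_sum poly_monom by (subst mon) (simp only: mult.assoc)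
  finally have "poly P (x k) = mpoly_eval x p" by simp
  moreover have "P \<in> polys_over (poly_ring R x V)"
    unfolding P_def using keys_rest coeff_R
    by (intro polys_over_sum polys_over_monom is_subring_poly_ring subring_mult
        pm_monomial_in_poly_ring coeff_in_poly_ring)
  ultimately have "P = 0" using t root by (auto simp: transcendental_over_def)
  have "Poly_Mapping.lookup p e = 0" if e: "e \<in> E" for e
  proof -
    define I where "I = {e' \<in> E. Poly_Mapping.lookup e' k = Poly_Mapping.lookup e k}"
    have "0 = coeff P (Poly_Mapping.lookup e k)" using \<open>P = 0\<close> by simp
    also have "\<dots> = (\<Sum>e'\<in>E. if Poly_Mapping.lookup e' k = Poly_Mapping.lookup e k
        then Poly_Mapping.lookup p e' * pm_monomial x (rest e') else 0)"
      by (simp add: P_def coeff_sum)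
    also have "\<dots> = (\<Sum>e'\<in>I. Poly_Mapping.lookup p e' * pm_monomial x (rest e'))"
      unfolding I_def by (simp add: sum.inter_filter E_def)
    finally have sum0: "(\<Sum>e'\<in>I. Poly_Mapping.lookup p e' * pm_monomial x (rest e')) = 0" by simp
    have inj: "inj_on rest I"
      by (rule inj_onI) (use split in \<open>metis (mono_tags, lifting) I_def mem_Collect_eq\<close>)
    show ?thesis
      by (rule alg_independentD_family[OF ind subring_0[OF R] _ inj _ _ sum0])
        (use keys_rest coeff_R e in \<open>auto simp: I_def E_def\<close>)
  qed
  then have "E = {}" by (metis E_def all_not_in_conv in_keys_iff)
  then show "p = 0" by (simp add: E_def)
qed

lemma gcd_subring_poly_ring:
  assumes R: "is_subring R" "gcd_subring R"
  shows "finite V \<Longrightarrow> alg_independent R x V \<Longrightarrow> gcd_subring (poly_ring R x V)"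
proof (induction V rule: finite_induct)
  case empty
  then show ?case using R by (simp add: poly_ring_empty)
next
  case (insert k V)
  have "alg_independent R x V" using insert.prems by (rule alg_independent_mono) auto
  then have "gcd_subring (poly_ring R x V)" by (rule insert.IH)
  then show ?case unfolding poly_ring_insert
    by (rule gcd_subring_poly_image[OF is_subring_poly_ring _
        alg_independent_insert_imp[OF R(1) insert.hyps(1,2) insert.prems]])
qed

lemma alg_independent_transcendental:
  assumes "is_subring R" "finite V" "alg_independent R x V" "k \<in> V"
  shows "transcendental_over (poly_ring R x (V - {k})) (x k)"
proof -
  have "insert k (V - {k}) = V" using assms(4) by blast
  then show ?thesis using assms(1-3) by (intro alg_independent_insert_imp) auto
qed

lemma alg_independent_nonzero:
  assumes R: "is_subring R" and V: "finite V" "alg_independent R x V" "k \<in> V"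
  shows "x k \<noteq> 0"
proof
  assume "x k = 0"
  then have "poly [:0, 1:] (x k) = 0" by simp
  moreover have "[:0, 1:] \<in> polys_over (poly_ring R x (V - {k}))"
    by (simp add: polys_over_pCons polys_over_0 subring_0 subring_1 is_subring_poly_ring)
  ultimately have "[:0, 1 :: 'a:] = 0"
    using alg_independent_transcendental[OF assms] unfolding transcendental_over_def by blast
  then show False by simp
qed

text \<open>Peel off the \<open>i\<close>-th variable: \<open>f\<close> does not contain it, so \<open>f / x i\<close> is as transcendental as \<open>x i\<close>.\<close>

lemma alg_independent_exchange:
  assumes R: "is_subring R" and V: "finite V" "alg_independent R x V" "i \<in> V"
    and f: "f \<in> poly_ring R x (V - {i})" "f \<noteq> 0"
  shows "alg_independent R (x(i := f / x i)) V"
proof -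
  let ?y = "x(i := f / x i)"
  have "transcendental_over (poly_ring R x (V - {i})) (f / x i)"
    by (intro transcendental_over_divide is_subring_poly_ring f alg_independent_transcendental assms)
  moreover have "poly_ring R x (V - {i}) = poly_ring R ?y (V - {i})"
    by (rule poly_ring_cong) auto
  moreover have "alg_independent R ?y (V - {i})"
    using alg_independent_mono[OF V(2), of "V - {i}"] alg_independent_cong[of "V - {i}" x ?y] by auto
  ultimately have "alg_independent R ?y (insert i (V - {i}))"
    using alg_independent_insertI[OF R, of i "V - {i}" ?y] by simp
  moreover have "insert i (V - {i}) = V" using V(3) by blast
  ultimately show ?thesis by simp
qed

lemma transcendental_over_laurent_ring:
  assumes V: "finite V" and nz: "\<And>k. k \<in> V \<Longrightarrow> x k \<noteq> 0"
    and t: "transcendental_over (poly_ring R x V) t"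
  shows "transcendental_over (laurent_ring R x V) t"
  unfolding transcendental_over_def
proof (intro ballI impI)
  let ?s = "\<Prod>k\<in>V. x k"
  have s: "?s \<in> poly_ring R x V" by (intro subring_prod is_subring_poly_ring var_in_poly_ring)
  have clear: "\<exists>N. smult (?s ^ N) p \<in> polys_over (poly_ring R x V)"
    if "p \<in> polys_over (laurent_ring R x V)" for p
    using that
  proof (induction p)
    case 0
    show ?case by (simp add: polys_over_0 is_subring_poly_ring)
  next
    case (pCons a p)
    then have a: "a \<in> laurent_ring R x V" and p: "p \<in> polys_over (laurent_ring R x V)"
      by (auto simp: polys_over_pCons is_subring_laurent_ring)
    obtain M where M: "a * ?s ^ M \<in> poly_ring R x V"
      using laurent_ring_monomial_denominator[OF V a] .
    obtain N where N: "smult (?s ^ N) p \<in> polys_over (poly_ring R x V)" using pCons.IH p by blast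
    have "?s ^ (M + N) * a = ?s ^ N * (a * ?s ^ M)"
      "smult (?s ^ (M + N)) p = smult (?s ^ M) (smult (?s ^ N) p)"
      by (simp_all add: power_add mult_ac)
    moreover have "?s ^ N * (a * ?s ^ M) \<in> poly_ring R x V"
      by (intro subring_mult[OF is_subring_poly_ring] M subring_power[OF is_subring_poly_ring] s)
    moreover have "smult (?s ^ M) (smult (?s ^ N) p) \<in> polys_over (poly_ring R x V)"
      by (intro polys_over_smult[OF is_subring_poly_ring] N subring_power[OF is_subring_poly_ring] s)
    ultimately have "smult (?s ^ (M + N)) (pCons a p) \<in> polys_over (poly_ring R x V)"
      by (simp only: smult_pCons polys_over_pCons[OF is_subring_poly_ring] simp_thms)
    then show ?case by blast
  qed
  fix p assume p: "p \<in> polys_over (laurent_ring R x V)" and root: "poly p t = 0"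
  obtain N where N: "smult (?s ^ N) p \<in> polys_over (poly_ring R x V)" using clear[OF p] by blast
  moreover have "poly (smult (?s ^ N) p) t = 0" using root by simp
  ultimately have "smult (?s ^ N) p = 0" using t unfolding transcendental_over_def by blast
  moreover have "?s \<noteq> 0" using V nz by simp
  ultimately show "p = 0" by simp
qed

section \<open>Laurent rings along one variable\<close>

text \<open>The Laurent ring is presented through the inverse of the \<open>j\<close>-th variable, since the elements
  of interest turn out to be polynomials in that inverse with invertible constant term.\<close>

lemma laurent_ring_as_poly_fraction:
  assumes j: "j \<in> V" and nz: "z j \<noteq> 0" and y: "y \<in> laurent_ring R z V"
  obtains N p where "p \<in> polys_over (laurent_ring R z (V - {j}))"
    "y * inverse (z j) ^ N = poly p (inverse (z j))"
proof -
  let ?D = "laurent_ring R z (V - {j})" and ?w = "inverse (z j)"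
  let ?E = "(\<lambda>p. poly p ?w) ` polys_over ?D"
  note D = is_subring_laurent_ring[of R z "V - {j}"]
  note E = is_subring_poly_image[OF D, of ?w]
  have DE: "a \<in> ?E" if "a \<in> ?D" for a using that by (rule coeff_in_poly_image[OF D])
  have w: "?w \<in> ?E" by (rule var_in_poly_image[OF D])
  have "\<exists>N. y * ?w ^ N \<in> ?E"
  proof (rule laurent_ring_clear_denominators[OF E _ w _ _ y])
    show "R \<subseteq> ?E" using DE coeff_in_laurent_ring by blast
    show "z k * ?w \<in> ?E" if k: "k \<in> V" for k
    proof (cases "k = j")
      case True
      then show ?thesis using nz subring_1[OF E] by simp
    next
      case False
      with k show ?thesis by (intro subring_mult[OF E _ w] DE var_in_laurent_ring) simp
    qed
    show "inverse (z k) * ?w \<in> ?E" if k: "k \<in> V" for k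
    proof (cases "k = j")
      case True
      then show ?thesis using subring_mult[OF E w w] by simp
    next
      case False
      with k show ?thesis by (intro subring_mult[OF E _ w] DE inverse_in_laurent_ring) simp
    qed
  qed blast
  with that show ?thesis by blast
qed

text \<open>Compare coefficients from the lowest degree upwards: modulo \<open>a\<close> and the earlier coefficients of
  \<open>p\<close>, the \<open>i\<close>-th coefficient of the product is a unit times that of \<open>p\<close>.\<close>

lemma dvd_within_cancel_unit_constant:
  assumes A: "is_subring A" and p: "p \<in> polys_over A" and q: "q \<in> polys_over A"
    and unit: "inverse (coeff q 0) \<in> A" "coeff q 0 \<noteq> 0"
    and dvd: "\<And>i. dvd_within A a (coeff (p * q) i)"
  shows "dvd_within A a (coeff p i)"
proof (induction i rule: less_induct)
  case (less i)
  have "coeff (p * q) i = (\<Sum>k\<in>{..<i}. coeff p k * coeff q (i - k)) + coeff p i * coeff q 0"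
    unfolding coeff_mult by (simp flip: lessThan_Suc_atMost)
  then have "coeff p i * coeff q 0 = coeff (p * q) i - (\<Sum>k\<in>{..<i}. coeff p k * coeff q (i - k))"
    by simp
  also have "dvd_within A a \<dots>"
    using less q by (intro dvd_within_diff dvd_within_sum dvd_within_mult_right A dvd)
      (auto intro: coeff_polys_over[OF A])
  finally have "dvd_within A a (coeff p i * coeff q 0 * inverse (coeff q 0))"
    by (rule dvd_within_mult_right[OF A _ unit(1)])
  moreover have "coeff p i * coeff q 0 * inverse (coeff q 0) = coeff p i"
    using unit(2) by simp
  ultimately show ?case by simp
qed

text \<open>Clear the powers of \<open>z j\<close>: then \<open>s\<close> becomes a polynomial in the inverse of \<open>z j\<close> whose constant
  term is a unit, and by transcendence divisibility by \<open>g\<close> can be tested on coefficients.\<close>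

lemma laurent_ring_nonzerodivisor:
  fixes R :: "'a::field set" and z :: "nat \<Rightarrow> 'a" and V :: "nat set" and j :: nat
  defines "D \<equiv> laurent_ring R z (V - {j})"
  assumes j: "j \<in> V" and nz: "z j \<noteq> 0" and t: "transcendental_over D (inverse (z j))"
    and g: "g \<in> D" "g \<noteq> 0"
    and q: "q \<in> polys_over D" "inverse (coeff q 0) \<in> D" "coeff q 0 \<noteq> 0"
    and s: "s * inverse (z j) ^ r = poly q (inverse (z j))"
    and Y: "Y \<in> laurent_ring R z V" "Y * s / g \<in> laurent_ring R z V"
  shows "Y / g \<in> laurent_ring R z V"
proof -
  let ?w = "inverse (z j)" and ?L = "laurent_ring R z V"
  have D: "is_subring D" by (simp add: D_def is_subring_laurent_ring)
  have DL: "D \<subseteq> ?L" unfolding D_def by (rule laurent_ring_mono) blast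
  obtain N p where p: "p \<in> polys_over D" "Y * ?w ^ N = poly p ?w"
    using laurent_ring_as_poly_fraction[OF j nz Y(1)] unfolding D_def by blast
  obtain M p' where p': "p' \<in> polys_over D" "Y * s / g * ?w ^ M = poly p' ?w"
    using laurent_ring_as_poly_fraction[OF j nz Y(2)] unfolding D_def by blast
  define P where "P = p * monom 1 M"
  define Q where "Q = p' * monom 1 (N + r)"
  have PQ: "P \<in> polys_over D" "Q \<in> polys_over D"
    unfolding P_def Q_def
    by (intro polys_over_mult[OF D] p p' polys_over_monom[OF D] subring_1[OF D])+
  have P_val: "poly P ?w = Y * ?w ^ (N + M)"
    by (simp add: P_def poly_monom power_add flip: p(2))
  have "poly (P * q - smult g Q) ?w = 0"
    using g by (simp add: P_val Q_def poly_monom power_add flip: s p'(2))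
  moreover have "P * q - smult g Q \<in> polys_over D"
    by (intro polys_over_diff[OF D] polys_over_mult[OF D] polys_over_smult[OF D] PQ q g)
  ultimately have "P * q - smult g Q = 0" using t unfolding transcendental_over_def by blast
  then have "P * q = smult g Q" by simp
  then have "dvd_within D g (coeff (P * q) i)" for i
    using coeff_polys_over[OF D PQ(2)] by (auto simp: dvd_within_def)
  then have "dvd_within D g (coeff P i)" for i
    using dvd_within_cancel_unit_constant[OF D PQ(1) q] by blast
  then obtain P' where P': "P' \<in> polys_over D" "P = smult g P'"
    using const_dvd_polyE[OF D g(2)] by blast
  have "Y / g = poly P' ?w * z j ^ (N + M)"
    using P_val nz g unfolding P'(2) by (simp add: field_simps power_inverse)
  moreover have "poly P' ?w \<in> ?L"
    by (rule poly_in_subring[OF D is_subring_laurent_ring DL inverse_in_laurent_ring[OF j] P'(1)])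
  ultimately show ?thesis
    by (auto intro!: subring_mult subring_power is_subring_laurent_ring var_in_laurent_ring j)
qed

text \<open>The powers of \<open>s\<close> are non-zero-divisors modulo \<open>g\<close> if \<open>s\<close> is, so one factor
  \<open>g\<close> of the denominator can be cancelled at a time.\<close>

lemma mem_if_two_denominators:
  fixes L :: "'a::field set"
  assumes L: "is_subring L" and s: "s \<in> L" and g: "g \<in> L" "g \<noteq> 0"
    and cancel: "\<And>Y. Y \<in> L \<Longrightarrow> Y * s / g \<in> L \<Longrightarrow> Y / g \<in> L"
    and ys: "y * s ^ M \<in> L"
  shows "y * g ^ N \<in> L \<Longrightarrow> y \<in> L"
proof (induction N)
  case (Suc N)
  have cancel_power: "Y * s ^ K / g \<in> L \<Longrightarrow> Y / g \<in> L" if "Y \<in> L" for Y K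
    using that
  proof (induction K arbitrary: Y)
    case (Suc K)
    have "Y * s / g \<in> L"
      using Suc.IH[of "Y * s"] Suc.prems L s by (simp add: subring_mult mult_ac)
    then show ?case using cancel Suc.prems by blast
  qed simp
  have "y * g ^ Suc N * s ^ M / g = y * s ^ M * g ^ N" using g by simp
  also have "\<dots> \<in> L" by (intro subring_mult[OF L] ys subring_power[OF L] g)
  finally have "y * g ^ Suc N / g \<in> L" by (rule cancel_power[OF Suc.prems])
  then have "y * g ^ N \<in> L" using g by simp
  then show ?case by (rule Suc.IH)
qed simp

section \<open>Exchange polynomials\<close>

text \<open>The conditions on a generalized seed are split into those on the matrix, those on the
  coefficients, and algebraic independence, because only the first two survive a mutation with
  vanishing exchange polynomial.\<close>

definition seed_matrix :: "nat \<Rightarrow> nat \<Rightarrow> (nat \<Rightarrow> nat) \<Rightarrow> (nat \<Rightarrow> nat \<Rightarrow> int) \<Rightarrow> bool" where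
  "seed_matrix n m d B \<longleftrightarrow> exchange_matrix n B \<and>
     (\<forall>i\<in>{1..n}. d i > 0 \<and> (\<forall>k\<in>{1..n+m}. int (d i) dvd B k i))"

definition seed_coeffs :: "'a::field set \<Rightarrow> nat \<Rightarrow> nat \<Rightarrow> (nat \<Rightarrow> nat) \<Rightarrow> (nat \<Rightarrow> 'a) \<Rightarrow> (nat \<Rightarrow> nat \<Rightarrow> 'a) \<Rightarrow> bool" where
  "seed_coeffs R n m d x \<rho> \<longleftrightarrow> (\<forall>i\<in>{1..n}. \<rho> i 0 = 1 \<and> \<rho> i (d i) = 1 \<and>
        (\<forall>j\<in>{1..d i - 1}. frozen_monomial R n m x (\<rho> i j)))"

lemma seed_matrixD:
  assumes "seed_matrix n m d B" "i \<in> {1..n}"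
  shows "d i > 0" "\<And>k. k \<in> {1..n+m} \<Longrightarrow> int (d i) dvd B k i"
  using assms by (auto simp: seed_matrix_def)

lemma exchange_matrix_sgn:
  assumes "exchange_matrix n B" "k \<in> {1..n}" "l \<in> {1..n}"
  shows "sgn (B k l) = - sgn (B l k)"
proof -
  obtain s :: "nat \<Rightarrow> int" where s: "s k > 0" "s l > 0" "s k * B k l = - (s l * B l k)"
    using assms unfolding exchange_matrix_def by meson
  from s(3) have "sgn (s k * B k l) = - sgn (s l * B l k)" by simp
  then show ?thesis using s(1,2) by (simp add: sgn_mult)
qed

lemma seed_matrix_diag:
  assumes "seed_matrix n m d B" "i \<in> {1..n}"
  shows "B i i = 0"
proof -
  have "sgn (B i i) = - sgn (B i i)"
    using assms by (intro exchange_matrix_sgn) (auto simp: seed_matrix_def)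
  then show ?thesis by (simp add: sgn_if split: if_splits)
qed

lemma seed_matrix_zero_sym:
  assumes "seed_matrix n m d B" "i \<in> {1..n}" "j \<in> {1..n}" "B i j = 0"
  shows "B j i = 0"
  using exchange_matrix_sgn[of n B i j] assms by (simp add: seed_matrix_def sgn_0_0)

lemma mutate_matrix_involutive: "mutate_matrix i (mutate_matrix i B) = B"
proof (intro ext)
  fix k l
  have "b + max a 0 * c + a * max (- c) 0 + (max (- a) 0 * - c + - a * max c 0) = b" for a b c :: int
    by (auto simp: max_def)
  then show "mutate_matrix i (mutate_matrix i B) k l = B k l"
    by (simp add: mutate_matrix_def add.assoc)
qed

text \<open>The same skew-symmetrizing multipliers \<open>s\<close> work for the mutated matrix. Both summands of the
  correction are rewritten by moving a positive multiplier into the positive part; the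
  first summand at \<open>(k, l)\<close> then is the negative of the second one at \<open>(l, k)\<close>.\<close>

lemma exchange_matrix_mutate:
  assumes "exchange_matrix n B" "i \<in> {1..n}"
  shows "exchange_matrix n (mutate_matrix i B)"
proof -
  obtain s :: "nat \<Rightarrow> int" where s: "\<And>k. k \<in> {1..n} \<Longrightarrow> s k > 0"
    "\<And>k l. k \<in> {1..n} \<Longrightarrow> l \<in> {1..n} \<Longrightarrow> s k * B k l = - (s l * B l k)"
    using assms unfolding exchange_matrix_def by blast
  have max_scale: "c * max a 0 = max (c * a) 0" if "c > 0" for a c :: int
    using that by (auto simp: max_def mult_le_0_iff zero_le_mult_iff)
  have "s k * mutate_matrix i B k l = - (s l * mutate_matrix i B l k)"
    if k: "k \<in> {1..n}" and l: "l \<in> {1..n}" for k l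
  proof (cases "k = i \<or> l = i")
    case True
    then show ?thesis using s(2)[OF k l] by (auto simp: mutate_matrix_def)
  next
    case False
    have e1: "s k * B k i = - (s i * B i k)" "s l * B l i = - (s i * B i l)"
      using s(2)[of k i] s(2)[of l i] k l assms(2) by simp_all
    have "s k * (max (B i l) 0 * B k i) = max (B i l) 0 * (s k * B k i)"
      by (rule mult.left_commute)
    also have "\<dots> = - (B i k * (s i * max (B i l) 0))" unfolding e1(1) by (simp add: mult_ac)
    also have "s i * max (B i l) 0 = max (- (s l * B l i)) 0"
      using e1 s(1)[OF assms(2)] by (simp add: max_scale)
    also have "\<dots> = s l * max (- B l i) 0" using s(1)[OF l] by (simp add: max_scale)
    finally have f1: "s k * (max (B i l) 0 * B k i) = - (s l * (B i k * max (- B l i) 0))"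
      by (simp add: mult_ac)
    have "s k * (B i l * max (- B k i) 0) = B i l * max (- (s k * B k i)) 0"
      using max_scale[OF s(1)[OF k], of "- B k i"] by (simp add: mult.left_commute)
    also have "max (- (s k * B k i)) 0 = s i * max (B i k) 0"
      using e1 s(1)[OF assms(2)] by (simp add: max_scale)
    finally have "s k * (B i l * max (- B k i) 0) = max (B i k) 0 * (s i * B i l)"
      by (simp add: mult_ac)
    also have "s i * B i l = - (s l * B l i)" using e1 by simp
    finally have f2: "s k * (B i l * max (- B k i) 0) = - (s l * (max (B i k) 0 * B l i))"
      by (simp add: mult_ac)
    show ?thesis using False s(2)[OF k l] f1 f2
      by (simp add: mutate_matrix_def algebra_simps)
  qed
  with s(1) show ?thesis unfolding exchange_matrix_def by blast
qed

lemma seed_matrix_mutate: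
  assumes "seed_matrix n m d B" "i \<in> {1..n}"
  shows "seed_matrix n m d (mutate_matrix i B)"
proof -
  have "int (d l) dvd mutate_matrix i B k l" if l: "l \<in> {1..n}" and k: "k \<in> {1..n+m}" for k l
  proof -
    have 1: "int (d l) dvd B k l" "int (d l) dvd B i l"
      using assms l k by (auto simp: seed_matrix_def)
    moreover from 1(2) have "int (d l) dvd max (B i l) 0" by (simp add: max_def)
    ultimately show ?thesis by (simp add: mutate_matrix_def)
  qed
  then show ?thesis using assms exchange_matrix_mutate by (auto simp: seed_matrix_def)
qed

lemma frozen_monomial_cong:
  "(\<And>k. k \<in> {n+1..n+m} \<Longrightarrow> x k = y k) \<Longrightarrow> frozen_monomial R n m x = frozen_monomial R n m y"
proof (intro ext)
  fix r assume *: "\<And>k. k \<in> {n+1..n+m} \<Longrightarrow> x k = y k"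
  have "(\<Prod>k\<in>{n+1..n+m}. x k ^ a k) = (\<Prod>k\<in>{n+1..n+m}. y k ^ a k)" for a :: "nat \<Rightarrow> nat"
    using * by (intro prod.cong) auto
  then show "frozen_monomial R n m x r = frozen_monomial R n m y r"
    unfolding frozen_monomial_def by simp
qed

lemma seed_coeffs_update:
  assumes "seed_coeffs R n m d x \<rho>" "i \<in> {1..n}"
  shows "seed_coeffs R n m d (x(i := a)) \<rho>"
proof -
  have "frozen_monomial R n m (x(i := a)) = frozen_monomial R n m x"
    using assms by (intro frozen_monomial_cong) auto
  then show ?thesis using assms by (auto simp: seed_coeffs_def)
qed

lemma seed_coeffs_mutate:
  assumes "seed_coeffs R n m d x \<rho>" "i \<in> {1..n}"
  shows "seed_coeffs R n m d (x(i := a)) (\<rho>(i := (\<lambda>j. \<rho> i (d i - j))))"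
proof -
  have rev: "d i - j \<in> {1..d i - 1}" if "j \<in> {1..d i - 1}" for j using that by auto
  show ?thesis
    using seed_coeffs_update[OF assms, of a] rev unfolding seed_coeffs_def by simp
qed

lemma seed_coeff_in_poly_ring:
  assumes "seed_coeffs R n m d x \<rho>" "i \<in> {1..n}" "j \<le> d i" "{n+1..n+m} \<subseteq> W"
  shows "\<rho> i j \<in> poly_ring R x W"
proof -
  consider "\<rho> i j = 1" | "frozen_monomial R n m x (\<rho> i j)"
    using assms by (cases "j = 0 \<or> j = d i") (auto simp: seed_coeffs_def)
  then show ?thesis
  proof cases
    case 2
    then obtain c a where "c \<in> R" "\<rho> i j = c * (\<Prod>k\<in>{n+1..n+m}. x k ^ a k)"
      by (auto simp: frozen_monomial_def)
    moreover have "x k ^ a k \<in> poly_ring R x W" if "k \<in> {n+1..n+m}" for k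
      using that assms(4) by (intro subring_power[OF is_subring_poly_ring] var_in_poly_ring) blast
    ultimately show ?thesis
      by (simp only: subring_mult[OF is_subring_poly_ring] coeff_in_poly_ring
          subring_prod[OF is_subring_poly_ring])
  qed (simp add: subring_1 is_subring_poly_ring)
qed

lemma exchange_poly_cong:
  assumes "\<And>j. j \<le> d i \<Longrightarrow> \<rho> i j = \<rho>' i j" "\<And>k. k \<in> {1..n+m} \<Longrightarrow> B k i = B' k i"
    "\<And>k. k \<in> {1..n+m} \<Longrightarrow> B k i \<noteq> 0 \<Longrightarrow> x k = y k"
  shows "exchange_poly n m d (x, \<rho>, B) i = exchange_poly n m d (y, \<rho>', B') i"
  unfolding exchange_poly.simps
proof (intro sum.cong refl arg_cong2[of _ _ _ _ "(*)"] prod.cong)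
  fix j k assume "j \<in> {0..d i}" "k \<in> {1..n+m}"
  then show "x k ^ (j * nat (B k i div int (d i)) + (d i - j) * nat (- (B k i div int (d i)))) =
    y k ^ (j * nat (B' k i div int (d i)) + (d i - j) * nat (- (B' k i div int (d i))))"
    using assms by (cases "B k i = 0") auto
qed (use assms in auto)

text \<open>Negating a column exchanges the two monomials of the exchange polynomial, which amounts to
  counting \<open>j\<close> backwards. So a mutation in direction \<open>i\<close> preserves the \<open>i\<close>-th exchange polynomial;
  the same symmetry also lets sign assumptions on an entry be made without loss of generality.\<close>

lemma exchange_poly_reverse:
  assumes dvd: "\<And>k. k \<in> {1..n+m} \<Longrightarrow> int (d i) dvd B k i"
    and B': "\<And>k. k \<in> {1..n+m} \<Longrightarrow> B' k i = - B k i"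
    and \<rho>': "\<And>j. j \<le> d i \<Longrightarrow> \<rho>' i j = \<rho> i (d i - j)"
  shows "exchange_poly n m d (x, \<rho>', B') i = exchange_poly n m d (x, \<rho>, B) i"
proof -
  have neg: "B' k i div int (d i) = - (B k i div int (d i))" if "k \<in> {1..n+m}" for k
    using that dvd[OF that] B' by (simp add: dvd_neg_div)
  show ?thesis unfolding exchange_poly.simps
    by (rule sum.reindex_bij_witness[of _ "\<lambda>j. d i - j" "\<lambda>j. d i - j"])
      (auto simp: \<rho>' neg add.commute intro!: prod.cong)
qed

lemma exchange_poly_in_poly_ring:
  assumes "seed_coeffs R n m d x \<rho>" "i \<in> {1..n}" "{n+1..n+m} \<subseteq> W"
    "\<And>k. k \<in> {1..n+m} \<Longrightarrow> B k i \<noteq> 0 \<Longrightarrow> k \<in> W"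
  shows "exchange_poly n m d (x, \<rho>, B) i \<in> poly_ring R x W"
  unfolding exchange_poly.simps
proof (intro subring_sum subring_mult subring_prod is_subring_poly_ring)
  fix j k assume "k \<in> {1..n+m}"
  then show "x k ^ (j * nat (B k i div int (d i)) + (d i - j) * nat (- (B k i div int (d i))))
      \<in> poly_ring R x W"
    using assms(4) by (cases "B k i = 0")
      (auto intro: subring_1 subring_power is_subring_poly_ring var_in_poly_ring)
next
  fix j assume "j \<in> {0..d i}"
  then show "\<rho> i j \<in> poly_ring R x W"
    by (intro seed_coeff_in_poly_ring[OF assms(1,2) _ assms(3)]) simp
qed

lemma exchange_poly_mutate_same:
  assumes B: "seed_matrix n m d B" and i: "i \<in> {1..n}"
  shows "exchange_poly n m d (mutate n m d i (x, \<rho>, B)) i = exchange_poly n m d (x, \<rho>, B) i"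
proof -
  let ?f = "exchange_poly n m d (x, \<rho>, B) i"
  have "exchange_poly n m d (mutate n m d i (x, \<rho>, B)) i = exchange_poly n m d (x(i := ?f / x i), \<rho>, B) i"
    unfolding mutate.simps using seed_matrixD[OF B i]
    by (intro exchange_poly_reverse) (auto simp: mutate_matrix_def)
  also have "\<dots> = exchange_poly n m d (x, \<rho>, B) i"
    using seed_matrix_diag[OF B i] by (intro exchange_poly_cong) auto
  finally show ?thesis .
qed

lemma exchange_poly_mutate_other:
  assumes "j \<noteq> i" "B i j = 0"
  shows "exchange_poly n m d (mutate n m d i (x, \<rho>, B)) j = exchange_poly n m d (x, \<rho>, B) j"
  unfolding mutate.simps using assms
  by (intro exchange_poly_cong) (auto simp: mutate_matrix_def split: if_splits)

text \<open>With \<open>b\<^sub>k\<^sub>i > 0\<close> the exponent of \<open>x\<^sub>k\<close> in the \<open>j\<close>-th summand is a positive multiple of \<open>j\<close>, so only the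
  summand with \<open>j = 0\<close> escapes the factor \<open>x\<^sub>k\<close>, and its coefficient is \<open>1\<close>.\<close>

lemma exchange_poly_leading_monomial_pos:
  assumes \<rho>: "\<And>j. j \<le> d i \<Longrightarrow> \<rho> i j \<in> poly_ring R x W" "\<rho> i 0 = 1"
    and d: "d i > 0" "\<And>l. l \<in> {1..n+m} \<Longrightarrow> int (d i) dvd B l i"
    and W: "\<And>l. l \<in> {1..n+m} \<Longrightarrow> B l i \<noteq> 0 \<Longrightarrow> l \<in> W"
    and k: "k \<in> {1..n+m}" "B k i > 0"
  shows "\<exists>h\<in>poly_ring R x W. exchange_poly n m d (x, \<rho>, B) i =
    (\<Prod>l\<in>{1..n+m}. x l ^ nat (- B l i)) + x k * h"
proof -
  define e where "e j l = j * nat (B l i div int (d i)) + (d i - j) * nat (- (B l i div int (d i)))" for j l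
  define h where "h = (\<Sum>j\<in>{1..d i}. \<rho> i j * (x k ^ (e j k - 1) * (\<Prod>l\<in>{1..n+m} - {k}. x l ^ e j l)))"
  have pow: "x l ^ (e j l) \<in> poly_ring R x W" if "l \<in> {1..n+m}" for j l
    using that W by (cases "B l i = 0")
      (auto simp: e_def intro: subring_1 subring_power is_subring_poly_ring var_in_poly_ring)
  have "h \<in> poly_ring R x W"
    unfolding h_def using k W
    by (intro subring_sum[OF is_subring_poly_ring] subring_mult[OF is_subring_poly_ring] \<rho>(1)
        subring_prod[OF is_subring_poly_ring] pow subring_power[OF is_subring_poly_ring] var_in_poly_ring) auto
  moreover have "exchange_poly n m d (x, \<rho>, B) i =
      (\<Sum>j\<in>{0..d i}. \<rho> i j * (\<Prod>l\<in>{1..n+m}. x l ^ e j l))"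
    by (simp add: e_def)
  moreover have "\<dots> = \<rho> i 0 * (\<Prod>l\<in>{1..n+m}. x l ^ e 0 l) +
      (\<Sum>j\<in>{1..d i}. \<rho> i j * (\<Prod>l\<in>{1..n+m}. x l ^ e j l))"
    by (subst sum.atLeast_Suc_atMost) simp_all
  moreover have "(\<Prod>l\<in>{1..n+m}. x l ^ e 0 l) = (\<Prod>l\<in>{1..n+m}. x l ^ nat (- B l i))"
  proof (rule prod.cong[OF refl])
    fix l assume that: "l \<in> {1..n+m}"
    have "int (d i) * (B l i div int (d i)) = B l i" using d(2)[OF that] by simp
    then have "nat (- B l i) = nat (int (d i) * - (B l i div int (d i)))" by simp
    also have "\<dots> = d i * nat (- (B l i div int (d i)))" by (subst nat_mult_distrib) auto
    finally show "x l ^ e 0 l = x l ^ nat (- B l i)" by (simp add: e_def)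
  qed
  moreover have "(\<Sum>j\<in>{1..d i}. \<rho> i j * (\<Prod>l\<in>{1..n+m}. x l ^ e j l)) = x k * h"
  proof -
    have "\<rho> i j * (\<Prod>l\<in>{1..n+m}. x l ^ e j l) =
        x k * (\<rho> i j * (x k ^ (e j k - 1) * (\<Prod>l\<in>{1..n+m} - {k}. x l ^ e j l)))"
      if "j \<in> {1..d i}" for j
    proof -
      have "B k i div int (d i) > 0" using k d by (simp add: pos_imp_zdiv_pos_iff zdvd_imp_le)
      then have "e j k > 0" using that by (simp add: e_def)
      then have "x k ^ e j k = x k * x k ^ (e j k - 1)" by (metis power_eq_if neq0_conv)
      moreover have "(\<Prod>l\<in>{1..n+m}. x l ^ e j l) = x k ^ e j k * (\<Prod>l\<in>{1..n+m} - {k}. x l ^ e j l)"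
        using k by (intro prod.remove) auto
      ultimately show ?thesis by (simp add: mult_ac)
    qed
    then show ?thesis unfolding h_def sum_distrib_left by (rule sum.cong[OF refl])
  qed
  ultimately have "h \<in> poly_ring R x W \<and> exchange_poly n m d (x, \<rho>, B) i =
      (\<Prod>l\<in>{1..n+m}. x l ^ nat (- B l i)) + x k * h"
    using \<rho>(2) by (simp only: mult_1)
  then show ?thesis by blast
qed

lemma exchange_poly_leading_monomial:
  assumes \<rho>: "seed_coeffs R n m d x \<rho>" and i: "i \<in> {1..n}" and B: "seed_matrix n m d B"
    and W: "{n+1..n+m} \<subseteq> W" "\<And>l. l \<in> {1..n+m} \<Longrightarrow> B l i \<noteq> 0 \<Longrightarrow> l \<in> W"
    and k: "k \<in> {1..n+m}" "B k i \<noteq> 0"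
  shows "\<exists>h\<in>poly_ring R x W. exchange_poly n m d (x, \<rho>, B) i =
    (\<Prod>l\<in>{1..n+m}. x l ^ nat (- sgn (B k i) * B l i)) + x k * h"
proof (cases "B k i > 0")
  case True
  then show ?thesis
    using exchange_poly_leading_monomial_pos[of d i \<rho> R x W n m B k] seed_matrixD[OF B i] W k \<rho> i
      seed_coeff_in_poly_ring[OF \<rho> i _ W(1)] by (simp add: seed_coeffs_def)
next
  case False
  let ?\<rho>' = "\<rho>(i := (\<lambda>j. \<rho> i (d i - j)))" and ?B' = "\<lambda>k l. - B k l"
  have "exchange_poly n m d (x, \<rho>, B) i = exchange_poly n m d (x, ?\<rho>', ?B') i"
    using seed_matrixD[OF B i] by (intro exchange_poly_reverse[symmetric]) auto
  moreover have "\<exists>h\<in>poly_ring R x W. exchange_poly n m d (x, ?\<rho>', ?B') i =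
      (\<Prod>l\<in>{1..n+m}. x l ^ nat (- ?B' l i)) + x k * h"
    using False seed_matrixD[OF B i] W k \<rho> i seed_coeff_in_poly_ring[OF \<rho> i _ W(1)]
    by (intro exchange_poly_leading_monomial_pos) (auto simp: seed_coeffs_def)
  ultimately show ?thesis using False k by simp
qed

lemma exchange_poly_zero_column:
  assumes "\<And>k. k \<in> {1..n+m} \<Longrightarrow> B k i = 0"
  shows "exchange_poly n m d (x, \<rho>, B) i = (\<Sum>j\<in>{0..d i}. \<rho> i j)"
  using assms by simp

text \<open>The leading monomial does not contain \<open>x\<^sub>k\<close>, so it cannot cancel against the multiple of \<open>x\<^sub>k\<close>
  that makes up the rest.\<close>

lemma exchange_poly_nonzero:
  assumes R: "is_subring R" and ind: "alg_independent R x {1..n+m}"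
    and \<rho>: "seed_coeffs R n m d x \<rho>" and i: "i \<in> {1..n}" and B: "seed_matrix n m d B"
    and k: "k \<in> {1..n+m}" "B k i \<noteq> 0"
  shows "exchange_poly n m d (x, \<rho>, B) i \<noteq> 0"
proof
  assume f0: "exchange_poly n m d (x, \<rho>, B) i = 0"
  let ?V = "{1..n+m}" and ?A = "poly_ring R x ({1..n+m} - {k})"
  define c where "c = (\<Prod>l\<in>?V. x l ^ nat (- sgn (B k i) * B l i))"
  obtain h where h: "h \<in> poly_ring R x ?V" "c + x k * h = 0"
    using exchange_poly_leading_monomial[OF \<rho> i B _ _ k, of ?V] f0 by (auto simp: c_def)
  have Vk: "insert k (?V - {k}) = ?V" using k by blast
  obtain q where q: "q \<in> polys_over ?A" "h = poly q (x k)"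
    using h(1) poly_ring_insert[of R x k "?V - {k}"] unfolding Vk by auto
  have "x l ^ nat (- sgn (B k i) * B l i) \<in> ?A" if "l \<in> ?V" for l
    using that by (cases "l = k")
      (auto simp: sgn_if subring_1 is_subring_poly_ring intro!: subring_power is_subring_poly_ring var_in_poly_ring)
  then have "c \<in> ?A" unfolding c_def by (intro subring_prod is_subring_poly_ring)
  then have "pCons c q \<in> polys_over ?A" "poly (pCons c q) (x k) = 0"
    using q h by (auto simp: polys_over_pCons is_subring_poly_ring)
  then have "pCons c q = 0"
    using alg_independent_transcendental[OF R _ ind k(1)] by (auto simp: transcendental_over_def)
  then have "c = 0" by simp
  moreover have "c \<noteq> 0" unfolding c_def
    using alg_independent_nonzero[OF R _ ind] by simp
  ultimately show False by simp
qed

lemma power_diff_factor: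
  assumes E: "is_subring E" and ab: "a \<in> E" "b \<in> E"
  shows "\<exists>k\<in>E. a ^ N - b ^ N = (a - b) * k"
proof (induction N)
  case 0
  then show ?case using E by (intro bexI[of _ 0]) (auto simp: subring_0)
next
  case (Suc N)
  then obtain k where k: "k \<in> E" "a ^ N - b ^ N = (a - b) * k" by blast
  have "a ^ Suc N - b ^ Suc N = a * (a ^ N - b ^ N) + (a - b) * b ^ N" by (simp add: algebra_simps)
  also have "\<dots> = (a - b) * (a * k + b ^ N)" unfolding k(2) by (simp add: algebra_simps)
  finally show ?case using k ab E by (auto intro!: bexI[of _ "a * k + b ^ N"] subring_add subring_mult subring_power)
qed

lemma exchange_poly_diff_factor:
  assumes E: "is_subring E" and ab: "a \<in> E" "b \<in> E" and i: "i \<in> {1..n+m}"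
    and \<rho>: "\<And>l. l \<le> d j \<Longrightarrow> \<rho> j l \<in> E"
    and x: "\<And>k. k \<in> {1..n+m} \<Longrightarrow> k \<noteq> i \<Longrightarrow> B k j \<noteq> 0 \<Longrightarrow> x k \<in> E"
  shows "\<exists>k\<in>E. exchange_poly n m d (x(i := a), \<rho>, B) j - exchange_poly n m d (x(i := b), \<rho>, B) j
    = (a - b) * k"
proof -
  let ?V = "{1..n+m}"
  define e where "e l k = l * nat (B k j div int (d j)) + (d j - l) * nat (- (B k j div int (d j)))" for l k
  define r where "r l = \<rho> j l * (\<Prod>k\<in>?V - {i}. x k ^ e l k)" for l
  have val: "exchange_poly n m d (x(i := c), \<rho>, B) j = (\<Sum>l\<in>{0..d j}. r l * c ^ e l i)" for c
  proof -
    have "(\<Prod>k\<in>?V. (x(i := c)) k ^ e l k) = c ^ e l i * (\<Prod>k\<in>?V - {i}. x k ^ e l k)" for l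
      using i by (subst prod.remove[of _ i]) (auto intro!: prod.cong)
    then show ?thesis by (simp add: r_def e_def mult_ac)
  qed
  have "x k ^ e l k \<in> E" if "k \<in> ?V - {i}" for k l
    using that x[of k] E by (cases "B k j = 0") (auto simp: e_def subring_1 subring_power)
  then have r: "r l \<in> E" if "l \<le> d j" for l
    unfolding r_def using that \<rho> by (intro subring_mult[OF E] subring_prod[OF E])
  have "\<forall>N. \<exists>k\<in>E. a ^ N - b ^ N = (a - b) * k" using power_diff_factor[OF E ab] by blast
  then obtain q where q: "\<And>N. q N \<in> E" "\<And>N. a ^ N - b ^ N = (a - b) * q N" by metis
  have "(\<Sum>l\<in>{0..d j}. r l * a ^ e l i) - (\<Sum>l\<in>{0..d j}. r l * b ^ e l i)
      = (\<Sum>l\<in>{0..d j}. r l * (a ^ e l i - b ^ e l i))"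
    by (simp add: sum_subtractf right_diff_distrib)
  also have "\<dots> = (a - b) * (\<Sum>l\<in>{0..d j}. r l * q (e l i))"
    by (simp add: q(2) sum_distrib_left mult_ac)
  finally show ?thesis unfolding val
    by (intro bexI) (assumption, intro subring_sum[OF E] subring_mult[OF E] r q, simp)
qed

text \<open>An exchange polynomial is a monomial times a one-variable polynomial with coefficients
  \<open>\<rho>\<^sub>j\<^sub>,\<^sub>l\<close> at the Laurent monomial with exponents \<open>\<beta>\<^sub>k\<^sub>j\<close> (the variable called \<open>y\<close>-hat in the theory of
  cluster algebras), because \<open>l [\<beta>]\<^sub>+ + (d - l) [-\<beta>]\<^sub>+ = l \<beta> + d [-\<beta>]\<^sub>+\<close>.\<close>

lemma exchange_poly_monomial_factor:
  assumes nz: "\<And>k. k \<in> {1..n+m} \<Longrightarrow> x k \<noteq> (0::'a::field)"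
  shows "exchange_poly n m d (x, \<rho>, B) j =
    (\<Prod>k\<in>{1..n+m}. x k ^ (d j * nat (- (B k j div int (d j))))) *
    (\<Sum>l\<in>{0..d j}. \<rho> j l * (\<Prod>k\<in>{1..n+m}. x k powi (B k j div int (d j))) ^ l)"
  unfolding exchange_poly.simps sum_distrib_left
proof (rule sum.cong[OF refl])
  fix l assume l: "l \<in> {0..d j}"
  have "x k ^ (l * nat b + (d j - l) * nat (- b)) = x k ^ (d j * nat (- b)) * (x k powi b) ^ l"
    if k: "k \<in> {1..n+m}" for k b
  proof (cases "b \<ge> 0")
    case True
    then show ?thesis by (simp add: power_int_def mult.commute flip: power_mult)
  next
    case False
    define c where "c = nat (- b)"
    have "x k powi b = inverse (x k ^ c)" using False by (simp add: power_int_def c_def power_inverse)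
    then have "x k ^ (d j * c) * (x k powi b) ^ l = x k ^ (d j * c) / x k ^ (c * l)"
      by (simp add: power_inverse power_mult field_simps)
    also have "\<dots> = x k ^ (d j * c - c * l)"
      using nz[OF k] l by (subst power_diff) (auto simp: mult.commute)
    finally show ?thesis using False by (simp add: c_def diff_mult_distrib2 mult_ac)
  qed
  then have "(\<Prod>k\<in>{1..n+m}. x k ^ (l * nat (B k j div int (d j)) + (d j - l) * nat (- (B k j div int (d j))))) =
      (\<Prod>k\<in>{1..n+m}. x k ^ (d j * nat (- (B k j div int (d j)))) * (x k powi (B k j div int (d j))) ^ l)"
    by (intro prod.cong) blast+
  then show "\<rho> j l * (\<Prod>k\<in>{1..n+m}. x k ^ (l * nat (B k j div int (d j)) + (d j - l) * nat (- (B k j div int (d j))))) =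
    (\<Prod>k\<in>{1..n+m}. x k ^ (d j * nat (- (B k j div int (d j))))) *
      (\<rho> j l * (\<Prod>k\<in>{1..n+m}. x k powi (B k j div int (d j))) ^ l)"
    by (simp only: prod.distrib prod_power_distrib mult.left_commute)
qed

section \<open>Two consecutive exchanges\<close>

definition unit_within :: "'a::field set \<Rightarrow> 'a \<Rightarrow> bool" where
  "unit_within A a \<longleftrightarrow> a \<in> A \<and> inverse a \<in> A \<and> a \<noteq> 0"

lemma unit_within_mult:
  "is_subring A \<Longrightarrow> unit_within A a \<Longrightarrow> unit_within A b \<Longrightarrow> unit_within A (a * b)"
  by (auto simp: unit_within_def intro: subring_mult)

lemma unit_within_inverse: "unit_within A a \<Longrightarrow> unit_within A (inverse a)"
  by (auto simp: unit_within_def)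

lemma unit_within_divide:
  "is_subring A \<Longrightarrow> unit_within A a \<Longrightarrow> unit_within A b \<Longrightarrow> unit_within A (a / b)"
  using unit_within_mult[of A a "inverse b"] unit_within_inverse[of A b] by (simp add: divide_inverse)

lemma unit_within_1: "is_subring A \<Longrightarrow> unit_within A 1"
  by (simp add: unit_within_def subring_1)

lemma unit_within_power: "is_subring A \<Longrightarrow> unit_within A a \<Longrightarrow> unit_within A (a ^ k)"
  by (induction k) (auto intro: unit_within_mult unit_within_1)

lemma unit_within_prod:
  "is_subring A \<Longrightarrow> (\<And>k. k \<in> I \<Longrightarrow> unit_within A (f k)) \<Longrightarrow> unit_within A (prod f I)"
  by (induction I rule: infinite_finite_induct) (auto intro: unit_within_mult unit_within_1)

lemma unit_within_laurent_ring_var: "k \<in> V \<Longrightarrow> x k \<noteq> 0 \<Longrightarrow> unit_within (laurent_ring R x V) (x k)"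
  by (simp add: unit_within_def var_in_laurent_ring inverse_in_laurent_ring)

lemma prod_powi: "(\<Prod>k\<in>I. f k) powi e = (\<Prod>k\<in>I. f k powi e)" for f :: "'b \<Rightarrow> 'a::field"
  by (induction I rule: infinite_finite_induct) (simp_all add: power_int_mult_distrib)

text \<open>For \<open>k \<noteq> i\<close> the mutation rule adds to \<open>\<beta>\<^sub>k\<^sub>j\<close> the product of \<open>\<beta>\<^sub>i\<^sub>j\<close> and the exponent of \<open>x\<^sub>k\<close> in \<open>c\<close>, and it
  negates \<open>\<beta>\<^sub>i\<^sub>j\<close>. This is what the substitution of \<open>c/u\<close> for \<open>x\<^sub>i\<close> does to the
  Laurent monomial with exponents \<open>\<beta>\<^sub>k\<^sub>j\<close>.\<close>

lemma exchange_monomial_substitution: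
  fixes x :: "nat \<Rightarrow> 'a::field" and B :: "nat \<Rightarrow> nat \<Rightarrow> int" and n m i j :: nat
  assumes B: "seed_matrix n m d B" and i: "i \<in> {1..n}" and j: "j \<in> {1..n}" and ij: "i \<noteq> j"
    and Bij: "B i j \<noteq> 0"
    and nz: "\<And>k. k \<in> {1..n+m} \<Longrightarrow> x k \<noteq> 0"
  defines "c \<equiv> \<Prod>l\<in>{1..n+m}. x l ^ nat (- sgn (B j i) * B l i)"
  shows "(\<Prod>k\<in>{1..n+m}. (x(i := c / u)) k powi (B k j div int (d j))) =
    (\<Prod>k\<in>{1..n+m}. (x(i := u)) k powi (mutate_matrix i B k j div int (d j)))"
proof -
  let ?V = "{1..n+m}"
  define \<beta> where "\<beta> k = B k j div int (d j)" for k
  define t where "t k = nat (- sgn (B j i) * B k i)" for k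
  have iV: "i \<in> ?V" using i by auto
  have fin: "finite ?V" by simp
  have sgn: "- sgn (B j i) = sgn (B i j)"
    using exchange_matrix_sgn[of n B i j] B i j by (simp add: seed_matrix_def)
  have ti: "t i = 0" by (simp add: t_def seed_matrix_diag[OF B i])
  have \<beta>': "mutate_matrix i B k j div int (d j) = \<beta> k + int (t k) * \<beta> i" if k: "k \<in> ?V" "k \<noteq> i" for k
  proof -
    have "mutate_matrix i B k j = B k j + int (t k) * B i j"
      using k ij Bij unfolding t_def sgn mutate_matrix_def
      by (auto simp: sgn_if max_def int_nat_eq algebra_simps split: if_splits)
    moreover have "int (d j) dvd B k j" "int (d j) dvd B i j"
      using seed_matrixD[OF B j] k iV by auto
    ultimately show ?thesis by (simp add: \<beta>_def div_mult_swap)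
  qed
  have \<beta>'i: "mutate_matrix i B i j div int (d j) = - \<beta> i"
    using seed_matrixD(2)[OF B j iV] by (simp add: mutate_matrix_def \<beta>_def dvd_neg_div)
  have c: "c = (\<Prod>k\<in>?V - {i}. x k ^ t k)"
    unfolding c_def using prod.remove[OF fin iV, of "\<lambda>k. x k ^ t k"] ti by (simp add: t_def)
  have "(\<Prod>k\<in>?V. (x(i := u)) k powi (mutate_matrix i B k j div int (d j))) =
      u powi (- \<beta> i) * (\<Prod>k\<in>?V - {i}. (x(i := u)) k powi (mutate_matrix i B k j div int (d j)))"
    by (subst prod.remove[OF fin iV]) (simp add: \<beta>'i)
  also have "(\<Prod>k\<in>?V - {i}. (x(i := u)) k powi (mutate_matrix i B k j div int (d j))) =
      (\<Prod>k\<in>?V - {i}. x k powi \<beta> k * (x k ^ t k) powi \<beta> i)"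
  proof (rule prod.cong[OF refl])
    fix k assume k: "k \<in> ?V - {i}"
    then have "x k \<noteq> 0" using nz by blast
    then show "(x(i := u)) k powi (mutate_matrix i B k j div int (d j)) = x k powi \<beta> k * (x k ^ t k) powi \<beta> i"
      using k \<beta>'[of k] by (simp add: power_int_add power_int_mult)
  qed
  also have "\<dots> = (\<Prod>k\<in>?V - {i}. x k powi \<beta> k) * c powi \<beta> i"
    by (simp add: prod.distrib c prod_powi)
  finally have "(\<Prod>k\<in>?V. (x(i := u)) k powi (mutate_matrix i B k j div int (d j))) =
      (c / u) powi \<beta> i * (\<Prod>k\<in>?V - {i}. x k powi \<beta> k)"
    by (simp add: power_int_divide_distrib power_int_minus field_simps)
  also have "\<dots> = (\<Prod>k\<in>?V. (x(i := c / u)) k powi \<beta> k)"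
    by (subst prod.remove[OF fin iV]) (simp add: \<beta>_def)
  finally show ?thesis by (simp add: \<beta>_def)
qed

text \<open>Both exchange polynomials are a monomial times the same polynomial in the same Laurent
  monomial. Neither monomial contains \<open>x\<^sub>j\<close>, so their quotient is a unit.\<close>

lemma exchange_poly_substitution:
  fixes x :: "nat \<Rightarrow> 'a::field" and B :: "nat \<Rightarrow> nat \<Rightarrow> int" and n m i j :: nat
  assumes B: "seed_matrix n m d B" and i: "i \<in> {1..n}" and j: "j \<in> {1..n}" and ij: "i \<noteq> j"
    and Bij: "B i j \<noteq> 0" and nz: "\<And>k. k \<in> {1..n+m} \<Longrightarrow> x k \<noteq> 0" and u: "u \<noteq> 0"
    and A: "is_subring A" and unit: "\<And>k. k \<in> {1..n+m} - {i, j} \<Longrightarrow> unit_within A (x k)" "unit_within A u"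
  defines "c \<equiv> \<Prod>l\<in>{1..n+m}. x l ^ nat (- sgn (B j i) * B l i)"
  shows "unit_within A (c / u)"
    "\<exists>\<alpha>. unit_within A \<alpha> \<and> exchange_poly n m d (x(i := c / u), \<rho>, B) j =
      \<alpha> * exchange_poly n m d (x(i := u), \<rho>(i := \<rho>'), mutate_matrix i B) j"
proof -
  let ?V = "{1..n+m}"
  have "unit_within A (x l ^ nat (- sgn (B j i) * B l i))" if l: "l \<in> ?V" for l
  proof (cases "l = i \<or> l = j")
    case True
    then have "nat (- sgn (B j i) * B l i) = 0"
      using seed_matrix_diag[OF B i] by (auto simp: sgn_if)
    then show ?thesis using A by (simp add: unit_within_1)
  next
    case False
    with l unit show ?thesis by (intro unit_within_power A) auto
  qed
  then have c: "unit_within A c" unfolding c_def by (intro unit_within_prod A)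
  show cu: "unit_within A (c / u)" by (intro unit_within_divide A c unit)
  have c0: "c / u \<noteq> 0" using cu by (simp add: unit_within_def)
  define mon where "mon a b = (\<Prod>k\<in>?V. (x(i := a)) k ^ (d j * nat (- (b k j div int (d j)))))"
    for a and b :: "nat \<Rightarrow> nat \<Rightarrow> int"
  define F where "F = (\<Sum>l\<in>{0..d j}. \<rho> j l * (\<Prod>k\<in>?V. (x(i := c / u)) k powi (B k j div int (d j))) ^ l)"
  have diag: "B j j = 0" "mutate_matrix i B j j = 0"
    using seed_matrix_diag[OF B j] seed_matrix_diag[OF seed_matrix_mutate[OF B i] j] by auto
  have mon_unit: "unit_within A (mon a b)" if a: "unit_within A a" and b: "b j j = 0" for a b
    unfolding mon_def
  proof (rule unit_within_prod[OF A])
    fix k assume k: "k \<in> ?V"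
    show "unit_within A ((x(i := a)) k ^ (d j * nat (- (b k j div int (d j)))))"
    proof (cases "k = j")
      case True
      then show ?thesis using b A by (simp add: unit_within_1)
    next
      case False
      with k a unit show ?thesis by (intro unit_within_power[OF A]) auto
    qed
  qed
  have 1: "exchange_poly n m d (x(i := c / u), \<rho>, B) j = mon (c / u) B * F"
    unfolding mon_def F_def by (rule exchange_poly_monomial_factor) (use nz c0 in auto)
  have 2: "exchange_poly n m d (x(i := u), \<rho>(i := \<rho>'), mutate_matrix i B) j = mon u (mutate_matrix i B) * F"
  proof -
    have "exchange_poly n m d (x(i := u), \<rho>(i := \<rho>'), mutate_matrix i B) j = mon u (mutate_matrix i B) *
      (\<Sum>l\<in>{0..d j}. (\<rho>(i := \<rho>')) j l * (\<Prod>k\<in>?V. (x(i := u)) k powi (mutate_matrix i B k j div int (d j))) ^ l)"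
      unfolding mon_def by (rule exchange_poly_monomial_factor) (use nz u in auto)
    also have "(\<Prod>k\<in>?V. (x(i := u)) k powi (mutate_matrix i B k j div int (d j))) =
        (\<Prod>k\<in>?V. (x(i := c / u)) k powi (B k j div int (d j)))"
      unfolding c_def by (rule exchange_monomial_substitution[OF B i j ij Bij nz, symmetric])
    finally show ?thesis using ij by (simp add: F_def)
  qed
  have units: "unit_within A (mon (c / u) B)" "unit_within A (mon u (mutate_matrix i B))"
    by (intro mon_unit cu unit diag)+
  then have "mon (c / u) B * F = (mon (c / u) B / mon u (mutate_matrix i B)) * (mon u (mutate_matrix i B) * F)"
    by (simp add: unit_within_def)
  with 1 2 unit_within_divide[OF A units] show "\<exists>\<alpha>. unit_within A \<alpha> \<and> exchange_poly n m d (x(i := c / u), \<rho>, B) j =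
      \<alpha> * exchange_poly n m d (x(i := u), \<rho>(i := \<rho>'), mutate_matrix i B) j"
    by metis
qed

text \<open>The statement about two denominators, with \<open>g\<close> clearing the
  denominators of the first ring and \<open>x i * w\<close> those of the second.\<close>

lemma laurent_ring_two_exchanges:
  fixes R :: "'a::field set" and x :: "nat \<Rightarrow> 'a" and V :: "nat set" and i j :: nat and u g w :: 'a
  assumes ij: "i \<in> V" "j \<in> V" "i \<noteq> j"
  defines "L \<equiv> laurent_ring R (x(i := u, j := g / x j)) V"
  assumes nz: "x j \<noteq> 0" "g \<noteq> 0"
    and g: "g \<in> L" and s: "x i \<in> L" "w \<in> L"
    and cancel: "\<And>Y. Y \<in> L \<Longrightarrow> Y * (x i * w) / g \<in> L \<Longrightarrow> Y / g \<in> L"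
    and yi: "y \<in> laurent_ring R (x(i := u)) V" and yj: "y \<in> laurent_ring R (x(j := w)) V"
  shows "y \<in> L"
proof -
  let ?z = "x(i := u, j := g / x j)"
  have L: "is_subring L" unfolding L_def by (rule is_subring_laurent_ring)
  have R: "R \<subseteq> L" unfolding L_def by (auto intro: coeff_in_laurent_ring)
  have z: "?z k \<in> L" "inverse (?z k) \<in> L" if "k \<in> V" for k
    using that unfolding L_def by (intro var_in_laurent_ring inverse_in_laurent_ring; assumption)+
  have sL: "x i * w \<in> L" by (intro subring_mult[OF L] s)
  obtain N where N: "y * g ^ N \<in> L"
  proof (rule laurent_ring_clear_denominators[OF L R g _ _ yi])
    show "(x(i := u)) k * g \<in> L" if k: "k \<in> V" for k
    proof (cases "k = j")
      case True
      have eq: "(x(i := u)) k * g = inverse (?z j) * (g * g)" using True ij nz by simp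
      show ?thesis unfolding eq by (intro subring_mult[OF L] z(2)[OF ij(2)] g)
    next
      case False
      then show ?thesis using z(1)[OF k] g subring_mult[OF L] by simp
    qed
    show "inverse ((x(i := u)) k) * g \<in> L" if k: "k \<in> V" for k
    proof (cases "k = j")
      case True
      have "inverse ((x(i := u)) k) * g = ?z j" using True ij by (simp add: divide_inverse mult.commute)
      then show ?thesis using z(1)[OF ij(2)] by simp
    next
      case False
      then show ?thesis using z(2)[OF k] g subring_mult[OF L] by simp
    qed
  qed blast
  obtain M where M: "y * (x i * w) ^ M \<in> L"
  proof (rule laurent_ring_clear_denominators[OF L R sL _ _ yj])
    have k_cases: "k = i \<or> k = j \<or> (k \<noteq> i \<and> k \<noteq> j \<and> ?z k = x k)" for k by auto
    show "(x(j := w)) k * (x i * w) \<in> L" if k: "k \<in> V" for k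
      using k_cases[of k] z[OF k] s sL ij(3) by (auto intro!: subring_mult[OF L _ sL])
    show "inverse ((x(j := w)) k) * (x i * w) \<in> L" if k: "k \<in> V" for k
    proof -
      consider "k = i" | "k = j" | "k \<noteq> i" "k \<noteq> j" by blast
      then show ?thesis
      proof cases
        case 1
        then have "inverse ((x(j := w)) k) * (x i * w) = (if x i = 0 then 0 else w)" using ij by simp
        then show ?thesis using s subring_0[OF L] by simp
      next
        case 2
        then have "inverse ((x(j := w)) k) * (x i * w) = (if w = 0 then 0 else x i)" by simp
        then show ?thesis using s subring_0[OF L] by simp
      next
        case 3
        then show ?thesis using z(2)[OF k] subring_mult[OF L _ sL] by simp
      qed
    qed
  qed blast
  show ?thesis by (rule mem_if_two_denominators[OF L sL g nz(2) cancel M N])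
qed

text \<open>The directions \<open>i\<close> and \<open>j\<close> interact. In terms of \<open>t = inverse (z j)\<close>, with coefficients in the Laurent
  ring \<open>D\<close> of the other variables, both \<open>x i\<close> and \<open>t * w\<close> are polynomials whose constant term
  is a unit: it is \<open>c / u\<close> for the first, and the quotient \<open>\<alpha>\<close> of the substituted exchange polynomial by
  \<open>g\<close> for the second.\<close>

lemma exchange_cancel_linked:
  fixes R :: "'a::field set" and x :: "nat \<Rightarrow> 'a" and \<rho> :: "nat \<Rightarrow> nat \<Rightarrow> 'a"
    and B :: "nat \<Rightarrow> nat \<Rightarrow> int" and d :: "nat \<Rightarrow> nat" and n m i j :: nat
  assumes R: "is_subring R" and ind: "alg_independent R x {1..n+m}"
    and \<rho>: "seed_coeffs R n m d x \<rho>" and B: "seed_matrix n m d B"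
    and i: "i \<in> {1..n}" and j: "j \<in> {1..n}" and ij: "i \<noteq> j" and Bij: "B i j \<noteq> 0"
  defines "f \<equiv> exchange_poly n m d (x, \<rho>, B) i" and "w \<equiv> exchange_poly n m d (x, \<rho>, B) j / x j"
    and "g \<equiv> exchange_poly n m d (mutate n m d i (x, \<rho>, B)) j"
  defines "z \<equiv> x(i := f / x i, j := g / x j)"
  assumes f0: "f \<noteq> 0" and g0: "g \<noteq> 0" and indz: "alg_independent R z {1..n+m}"
    and gD: "g \<in> laurent_ring R z ({1..n+m} - {j})"
  shows "x i \<in> laurent_ring R z {1..n+m}" "w \<in> laurent_ring R z {1..n+m}"
    "\<And>Y. Y \<in> laurent_ring R z {1..n+m} \<Longrightarrow> Y * (x i * w) / g \<in> laurent_ring R z {1..n+m} \<Longrightarrow>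
       Y / g \<in> laurent_ring R z {1..n+m}"
proof -
  let ?V = "{1..n+m}"
  define u where "u = f / x i"
  define D where "D = laurent_ring R z (?V - {j})"
  define t where "t = inverse (z j)"
  define E where "E = (\<lambda>p. poly p t) ` polys_over D"
  define L where "L = laurent_ring R z ?V"
  have iV: "i \<in> ?V" and jV: "j \<in> ?V" using i j by auto
  have nz: "x k \<noteq> 0" if "k \<in> ?V" for k using alg_independent_nonzero[OF R _ ind that] by simp
  have nzz: "z k \<noteq> 0" if "k \<in> ?V" for k using alg_independent_nonzero[OF R _ indz that] by simp
  have u0: "u \<noteq> 0" using f0 nz[OF iV] by (simp add: u_def)
  have zi: "z i = u" and zj: "z j = g / x j" and zk: "\<And>k. k \<noteq> i \<Longrightarrow> k \<noteq> j \<Longrightarrow> z k = x k"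
    using ij by (simp_all add: z_def u_def)
  have D: "is_subring D" unfolding D_def by (rule is_subring_laurent_ring)
  have L: "is_subring L" unfolding L_def by (rule is_subring_laurent_ring)
  have E: "is_subring E" unfolding E_def by (rule is_subring_poly_image[OF D])
  have DE: "a \<in> E" if "a \<in> D" for a using that unfolding E_def by (rule coeff_in_poly_image[OF D])
  have tE: "t \<in> E" unfolding E_def by (rule var_in_poly_image[OF D])
  have DL: "D \<subseteq> L" unfolding D_def L_def by (rule laurent_ring_mono) blast
  have "t \<in> L" unfolding L_def t_def by (rule inverse_in_laurent_ring[OF jV])
  then have EL: "E \<subseteq> L" unfolding E_def using poly_in_subring[OF D L DL] by blast
  have unit_u: "unit_within D u"
    unfolding D_def zi[symmetric] by (rule unit_within_laurent_ring_var) (use iV ij nzz in auto)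
  have unit_x: "unit_within D (x k)" if "k \<in> ?V - {i, j}" for k
    unfolding D_def using that zk[of k] unit_within_laurent_ring_var[of k "?V - {j}" z R] nzz[of k] by auto
  have trans: "transcendental_over D t"
  proof -
    have "transcendental_over (poly_ring R z (?V - {j})) (1 / z j)"
      by (intro transcendental_over_divide is_subring_poly_ring alg_independent_transcendental R indz jV
          subring_1) auto
    then show ?thesis unfolding D_def t_def inverse_eq_divide
      by (intro transcendental_over_laurent_ring) (use nzz in auto)
  qed
  have gE: "g \<in> E" using gD DE by (simp add: D_def)
  have xj: "x j = t * g" using g0 nz[OF jV] by (simp add: t_def zj)
  have xE: "x k \<in> E" if "k \<in> ?V - {i}" for k
  proof (cases "k = j")
    case True
    then show ?thesis using xj tE gE subring_mult[OF E] by simp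
  next
    case False
    then show ?thesis using unit_x[of k] that DE by (auto simp: unit_within_def)
  qed
  have PE: "poly_ring R x (?V - {i}) \<subseteq> E"
    by (intro poly_ring_least E xE) (auto intro!: DE simp: D_def coeff_in_laurent_ring)
  \<comment> \<open>the summand of the \<open>i\<close>-th exchange polynomial that does not contain \<open>x j\<close>\<close>
  define c where "c = (\<Prod>l\<in>?V. x l ^ nat (- sgn (B j i) * B l i))"
  have Bji: "B j i \<noteq> 0" using seed_matrix_zero_sym[OF B j i] Bij by blast
  obtain h where h: "h \<in> poly_ring R x (?V - {i})" "f = c + x j * h"
  proof -
    have "\<exists>h\<in>poly_ring R x (?V - {i}). f = c + x j * h"
      unfolding f_def c_def
      by (rule exchange_poly_leading_monomial[OF \<rho> i B _ _ jV Bji])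
        (use i seed_matrix_diag[OF B i] in auto)
    with that show ?thesis by blast
  qed
  have g_eq: "g = exchange_poly n m d (x(i := u), \<rho>(i := (\<lambda>l. \<rho> i (d i - l))), mutate_matrix i B) j"
    by (simp only: g_def mutate.simps u_def f_def)
  have cu: "unit_within D (c / u)"
    unfolding c_def by (rule exchange_poly_substitution(1)[OF B i j ij Bij _ u0 D _ unit_u]) (fact nz unit_x)+
  have "\<exists>\<alpha>. unit_within D \<alpha> \<and> exchange_poly n m d (x(i := c / u), \<rho>, B) j = \<alpha> * g"
    unfolding c_def g_eq
    by (rule exchange_poly_substitution(2)[OF B i j ij Bij _ u0 D _ unit_u]) (fact nz unit_x)+
  then obtain \<alpha> where \<alpha>: "unit_within D \<alpha>"
    "exchange_poly n m d (x(i := c / u), \<rho>, B) j = \<alpha> * g" by blast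
  have inv_u: "inverse u \<in> E" using unit_u DE by (simp add: unit_within_def)
  have hE: "h \<in> E" using h PE by blast
  have "x i = f / u" using f0 nz[OF iV] by (simp add: u_def)
  then have xi: "x i = c / u + t * (g * h * inverse u)"
    using h(2) u0 by (simp add: xj field_simps)
  have q1E: "g * h * inverse u \<in> E" by (intro subring_mult[OF E] gE hE inv_u)
  have cuE: "c / u \<in> E" using cu DE by (simp add: unit_within_def)
  have xiE: "x i \<in> E" unfolding xi by (intro subring_add[OF E] subring_mult[OF E] cuE tE q1E)
  obtain k where k: "k \<in> E" "exchange_poly n m d (x, \<rho>, B) j - \<alpha> * g = (x i - c / u) * k"
  proof -
    have "{n+1..n+m} \<subseteq> ?V - {i}" using i by auto
    then have "\<rho> j l \<in> E" if "l \<le> d j" for l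
      using seed_coeff_in_poly_ring[OF \<rho> j that] PE by blast
    then have "\<exists>k\<in>E. exchange_poly n m d (x(i := x i), \<rho>, B) j - exchange_poly n m d (x(i := c / u), \<rho>, B) j
        = (x i - c / u) * k"
      by (intro exchange_poly_diff_factor E xiE cuE iV xE) auto
    with that show ?thesis unfolding \<alpha>(2) by auto
  qed
  \<comment> \<open>both \<open>\<alpha> * g\<close> and \<open>x i - c / u = t * g * h / u\<close> contain the factor \<open>g\<close> of \<open>x j = t * g\<close>\<close>
  have tw: "t * w = \<alpha> + t * (h * inverse u * k)"
  proof -
    have "exchange_poly n m d (x, \<rho>, B) j = g * (\<alpha> + t * (h * inverse u * k))"
      using k(2) xi by (simp add: algebra_simps)
    then have "w = g * (\<alpha> + t * (h * inverse u * k)) / (t * g)" by (simp only: w_def xj)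
    moreover have "t \<noteq> 0" using nzz[OF jV] by (simp add: t_def)
    ultimately show ?thesis using g0 by simp
  qed
  have q2E: "h * inverse u * k \<in> E" by (intro subring_mult[OF E] hE inv_u k)
  have t0: "t \<noteq> 0" using nzz[OF jV] by (simp add: t_def)
  show "x i \<in> laurent_ring R z ?V" using xiE EL by (auto simp: L_def)
  have "w = (\<alpha> + t * (h * inverse u * k)) * z j" using tw t0 by (simp add: t_def field_simps)
  moreover have "\<alpha> + t * (h * inverse u * k) \<in> L"
    using \<alpha> DE by (intro EL[THEN subsetD] subring_add[OF E] subring_mult[OF E _ q2E] tE)
      (auto simp: unit_within_def)
  ultimately show "w \<in> laurent_ring R z ?V"
    using subring_mult[OF L] var_in_laurent_ring[OF jV, of z R] by (simp add: L_def)
  obtain p1 where p1: "p1 \<in> polys_over D" "g * h * inverse u = poly p1 t" using q1E by (auto simp: E_def)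
  obtain p2 where p2: "p2 \<in> polys_over D" "h * inverse u * k = poly p2 t" using q2E by (auto simp: E_def)
  define Q where "Q = pCons (c / u) p1 * pCons \<alpha> p2"
  have Q: "Q \<in> polys_over D" unfolding Q_def using p1 p2 cu \<alpha>
    by (intro polys_over_mult[OF D]) (auto simp: polys_over_pCons[OF D] unit_within_def)
  have Q0: "unit_within D (coeff Q 0)"
    unfolding Q_def using unit_within_mult[OF D cu \<alpha>(1)] by (simp add: coeff_mult mult.commute)
  have "x i * w * inverse (z j) ^ 1 = x i * (t * w)" by (simp add: t_def mult_ac)
  also have "\<dots> = poly (pCons (c / u) p1) t * poly (pCons \<alpha> p2) t"
    unfolding tw xi p1(2) p2(2) by simp
  finally have "x i * w * inverse (z j) ^ 1 = poly Q t" by (simp only: Q_def poly_mult)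
  then show "Y / g \<in> laurent_ring R z ?V"
    if "Y \<in> laurent_ring R z ?V" "Y * (x i * w) / g \<in> laurent_ring R z ?V" for Y
    using that Q Q0 trans gD g0 nzz[OF jV]
    unfolding D_def t_def unit_within_def
    by (intro laurent_ring_nonzerodivisor[OF jV, of z R g Q "x i * w" 1 Y]) blast+
qed

text \<open>After clearing monomials, this is Euclid's lemma in the polynomial ring.\<close>

lemma exchange_cancel_coprime:
  fixes z :: "nat \<Rightarrow> 'a::field"
  assumes V: "finite V" and nz: "\<And>k. k \<in> V \<Longrightarrow> z k \<noteq> 0" and G: "gcd_subring (poly_ring R z V)"
    and f: "f \<in> poly_ring R z V" and g: "g \<in> poly_ring R z V" "g \<noteq> 0"
    and cop: "coprime_in (poly_ring R z V) f g"
    and Y: "Y \<in> laurent_ring R z V" "Y * f / g \<in> laurent_ring R z V"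
  shows "Y / g \<in> laurent_ring R z V"
proof -
  let ?P = "poly_ring R z V" and ?L = "laurent_ring R z V" and ?s = "\<Prod>k\<in>V. z k"
  note P = is_subring_poly_ring[of R z V] and L = is_subring_laurent_ring[of R z V]
  obtain M where M: "Y * ?s ^ M \<in> ?P" using laurent_ring_monomial_denominator[OF V Y(1)] .
  obtain N where N: "Y * f / g * ?s ^ N \<in> ?P" using laurent_ring_monomial_denominator[OF V Y(2)] .
  have sP: "?s ^ k \<in> ?P" for k by (intro subring_power[OF P] subring_prod[OF P] var_in_poly_ring)
  have s_unit: "unit_within ?L ?s"
    by (intro unit_within_prod L unit_within_laurent_ring_var nz)
  define H where "H = Y * ?s ^ M * ?s ^ N"
  have H: "H \<in> ?P" unfolding H_def by (intro subring_mult[OF P] M sP)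
  have "f * H = g * (Y * f / g * ?s ^ N * ?s ^ M)" using g by (simp add: H_def)
  moreover have "Y * f / g * ?s ^ N * ?s ^ M \<in> ?P" by (intro subring_mult[OF P] N sP)
  ultimately have "dvd_within ?P g (f * H)" unfolding dvd_within_def by blast
  then obtain e where e: "e \<in> ?P" "H = g * e"
    using coprime_in_gcd_subring[OF P G f g cop H] by (auto simp: dvd_within_def)
  have "?s \<noteq> 0" using s_unit by (simp add: unit_within_def)
  then have "Y / g = e * inverse ?s ^ (M + N)"
    using e(2) g(2) by (simp add: H_def power_add power_inverse field_simps)
  moreover have "e \<in> ?L" using e(1) poly_ring_subset_laurent_ring by blast
  moreover have "inverse ?s \<in> ?L" using s_unit by (simp add: unit_within_def)
  ultimately show ?thesis by (simp add: subring_mult[OF L] subring_power[OF L])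
qed

lemma cluster_mutate: "cluster (mutate n m d i (x, \<rho>, B)) = x(i := exchange_poly n m d (x, \<rho>, B) i / x i)"
  by simp

proposition laurent_ring_exchange_inclusion:
  fixes x :: "nat \<Rightarrow> 'a::field"
  assumes R: "is_subring R" and G: "gcd_subring R" and ind: "alg_independent R x {1..n+m}"
    and \<rho>: "seed_coeffs R n m d x \<rho>" and B: "seed_matrix n m d B"
    and i: "i \<in> {1..n}" and j: "j \<in> {1..n}" and ij: "i \<noteq> j"
    and f0: "exchange_poly n m d (x, \<rho>, B) i \<noteq> 0"
    and g0: "exchange_poly n m d (mutate n m d i (x, \<rho>, B)) j \<noteq> 0"
    and cop: "coprime_seed R n m d (mutate n m d j (mutate n m d i (x, \<rho>, B)))"
  shows "laurent_ring R (cluster (mutate n m d i (x, \<rho>, B))) {1..n+m} \<inter>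
      laurent_ring R (cluster (mutate n m d j (x, \<rho>, B))) {1..n+m}
    \<subseteq> laurent_ring R (cluster (mutate n m d j (mutate n m d i (x, \<rho>, B)))) {1..n+m}"
proof (rule subsetI, elim IntE)
  let ?V = "{1..n+m}"
  define f where "f = exchange_poly n m d (x, \<rho>, B) i"
  define g where "g = exchange_poly n m d (mutate n m d i (x, \<rho>, B)) j"
  define w where "w = exchange_poly n m d (x, \<rho>, B) j / x j"
  define x1 where "x1 = x(i := f / x i)"
  define z where "z = x(i := f / x i, j := g / x j)"
  let ?\<rho>1 = "\<rho>(i := (\<lambda>l. \<rho> i (d i - l)))" and ?B1 = "mutate_matrix i B"
  have iV: "i \<in> ?V" and jV: "j \<in> ?V" using i j by auto
  have mut1: "mutate n m d i (x, \<rho>, B) = (x1, ?\<rho>1, ?B1)" by (simp add: x1_def f_def)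
  have z_eq: "z = x1(j := g / x1 j)" using ij by (simp add: z_def x1_def)
  have clz: "cluster (mutate n m d j (mutate n m d i (x, \<rho>, B))) = z"
    unfolding mut1 cluster_mutate z_eq by (simp only: g_def mut1)
  have \<rho>1: "seed_coeffs R n m d x1 ?\<rho>1" unfolding x1_def by (rule seed_coeffs_mutate[OF \<rho> i])
  have B1: "seed_matrix n m d ?B1" by (rule seed_matrix_mutate[OF B i])
  have f_mem: "f \<in> poly_ring R x (?V - {i})" unfolding f_def
    by (rule exchange_poly_in_poly_ring[OF \<rho> i]) (use i seed_matrix_diag[OF B i] in auto)
  have g_mem: "g \<in> poly_ring R x1 (?V - {j})" unfolding g_def mut1
    by (rule exchange_poly_in_poly_ring[OF \<rho>1 j]) (use j seed_matrix_diag[OF B1 j] in auto)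
  have "alg_independent R x1 ?V" unfolding x1_def
    by (rule alg_independent_exchange[OF R _ ind iV f_mem]) (use f0 in \<open>simp_all add: f_def\<close>)
  then have indz: "alg_independent R z ?V" unfolding z_eq
    by (rule alg_independent_exchange[OF R _ _ jV g_mem, rotated]) (use g0 in \<open>simp_all add: g_def\<close>)
  have nz: "x k \<noteq> 0" if "k \<in> ?V" for k using alg_independent_nonzero[OF R _ ind that] by simp
  have nzz: "z k \<noteq> 0" if "k \<in> ?V" for k using alg_independent_nonzero[OF R _ indz that] by simp
  have "poly_ring R x1 (?V - {j}) = poly_ring R z (?V - {j})"
    by (rule poly_ring_cong) (auto simp: z_eq)
  with g_mem have g_memz: "g \<in> poly_ring R z (?V - {j})" by simp
  then have gD: "g \<in> laurent_ring R z (?V - {j})" and gP: "g \<in> poly_ring R z ?V"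
    using poly_ring_subset_laurent_ring poly_ring_mono[of "?V - {j}" ?V] by blast+
  then have gL: "g \<in> laurent_ring R z ?V" using poly_ring_subset_laurent_ring by blast
  have main: "x i \<in> laurent_ring R z ?V \<and> w \<in> laurent_ring R z ?V \<and>
     (\<forall>Y. Y \<in> laurent_ring R z ?V \<longrightarrow> Y * (x i * w) / g \<in> laurent_ring R z ?V \<longrightarrow>
       Y / g \<in> laurent_ring R z ?V)"
  proof (cases "B i j = 0")
    case False
    note cancel = exchange_cancel_linked[OF R ind \<rho> B i j ij False, folded f_def g_def w_def, folded z_def,
      OF f0[folded f_def] g0[folded g_def] indz gD]
    from cancel show ?thesis by blast
  next
    case True
    let ?t = "mutate n m d j (mutate n m d i (x, \<rho>, B))"
    have "B j i = 0" by (rule seed_matrix_zero_sym[OF B i j True])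
    then have "?B1 j i = 0" by (simp add: mutate_matrix_def)
    then have "exchange_poly n m d ?t i = exchange_poly n m d (x1, ?\<rho>1, ?B1) i"
      unfolding mut1 using ij by (intro exchange_poly_mutate_other) auto
    also have "\<dots> = f"
      using exchange_poly_mutate_same[OF B i, of x \<rho>] unfolding mut1 f_def .
    finally have fi: "exchange_poly n m d ?t i = f" .
    have gj: "exchange_poly n m d ?t j = g"
      unfolding g_def mut1 by (rule exchange_poly_mutate_same[OF B1 j])
    have gw: "g = exchange_poly n m d (x, \<rho>, B) j"
      unfolding g_def by (rule exchange_poly_mutate_other) (use ij True in auto)
    have coprime: "coprime_in (poly_ring R z ?V) f g"
      using cop i j ij unfolding coprime_seed_def clz fi[symmetric] gj[symmetric] by blast
    have "f \<in> poly_ring R x (?V - {i, j})" unfolding f_def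
    proof (rule exchange_poly_in_poly_ring[OF \<rho> i])
      show "{n + 1..n + m} \<subseteq> ?V - {i, j}" using i j by auto
      show "k \<in> ?V - {i, j}" if "k \<in> ?V" "B k i \<noteq> 0" for k
        using that seed_matrix_diag[OF B i] \<open>B j i = 0\<close> by auto
    qed
    also have "poly_ring R x (?V - {i, j}) = poly_ring R z (?V - {i, j})"
      by (rule poly_ring_cong) (auto simp: z_def)
    finally have fP: "f \<in> poly_ring R z ?V" using poly_ring_mono[of "?V - {i, j}" ?V] by blast
    have GP: "gcd_subring (poly_ring R z ?V)"
      by (rule gcd_subring_poly_ring[OF R G _ indz]) simp
    have zi: "z i = f / x i" and zj: "z j = w" using ij by (simp_all add: z_def w_def gw)
    have ui: "unit_within (laurent_ring R z ?V) (z i)" and uj: "unit_within (laurent_ring R z ?V) (z j)"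
      by (intro unit_within_laurent_ring_var nzz iV jV)+
    note L = is_subring_laurent_ring[of R z ?V]
    have fL: "f \<in> laurent_ring R z ?V" using fP poly_ring_subset_laurent_ring by blast
    have xi: "x i = f * inverse (z i)" using nz[OF iV] f0 by (simp add: zi f_def)
    show ?thesis
    proof (intro conjI allI impI)
      show "x i \<in> laurent_ring R z ?V" unfolding xi using fL ui subring_mult[OF L]
        by (simp add: unit_within_def)
      show "w \<in> laurent_ring R z ?V" using uj by (simp add: zj unit_within_def)
      fix Y assume Y: "Y \<in> laurent_ring R z ?V" "Y * (x i * w) / g \<in> laurent_ring R z ?V"
      have "Y * f / g = Y * (x i * w) / g * z i * inverse (z j)"
        using nzz[OF iV] nzz[OF jV] by (simp add: xi field_simps flip: zj)
      also have "\<dots> \<in> laurent_ring R z ?V"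
        using Y(2) ui uj by (intro subring_mult[OF L]) (auto simp: unit_within_def)
      finally show "Y / g \<in> laurent_ring R z ?V"
        by (intro exchange_cancel_coprime[OF _ nzz GP fP gP _ coprime Y(1)])
          (use g0 in \<open>simp_all add: g_def\<close>)
    qed
  qed
  fix y assume yi: "y \<in> laurent_ring R (cluster (mutate n m d i (x, \<rho>, B))) ?V"
    and yj: "y \<in> laurent_ring R (cluster (mutate n m d j (x, \<rho>, B))) ?V"
  have "y \<in> laurent_ring R z ?V"
    unfolding z_def
  proof (rule laurent_ring_two_exchanges[OF iV jV ij])
    show "y \<in> laurent_ring R (x(i := f / x i)) ?V" using yi by (simp only: cluster_mutate f_def)
    show "y \<in> laurent_ring R (x(j := w)) ?V" using yj by (simp only: cluster_mutate w_def)
  qed (use main gL nz[OF jV] g0 in \<open>simp_all add: g_def z_def\<close>)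
  then show "y \<in> laurent_ring R (cluster (mutate n m d j (mutate n m d i (x, \<rho>, B)))) ?V"
    by (simp only: clz)
qed

section \<open>Mutation-equivalent seeds\<close>

lemma mutation_equivalent_refl: "mutation_equivalent n m d s s"
  by (simp add: mutation_equivalent_def)

lemma mutation_equivalent_mutate:
  "mutation_equivalent n m d s t \<Longrightarrow> i \<in> {1..n} \<Longrightarrow> mutation_equivalent n m d s (mutate n m d i t)"
  unfolding mutation_equivalent_def by (rule rtranclp.rtrancl_into_rtrancl) auto

lemma mutation_equivalent_induct [consumes 1, case_names refl mutate]:
  assumes "mutation_equivalent n m d s t" "P s"
    "\<And>t i. mutation_equivalent n m d s t \<Longrightarrow> P t \<Longrightarrow> i \<in> {1..n} \<Longrightarrow> P (mutate n m d i t)"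
  shows "P t"
  using assms(1) unfolding mutation_equivalent_def
  by (induction rule: rtranclp_induct) (use assms(2,3) in \<open>auto simp: mutation_equivalent_def\<close>)

lemma upper_bound_cong:
  assumes "cluster s = cluster t"
    "\<And>i. i \<in> {1..n} \<Longrightarrow> cluster (mutate n m d i s) = cluster (mutate n m d i t)"
  shows "upper_bound R n m d s = upper_bound R n m d t"
  using assms unfolding upper_bound_def by (auto 0 3)

lemma upper_bound_subset: "upper_bound R n m d s \<subseteq> laurent_ring R (cluster s) {1..n+m}"
  by (simp add: upper_bound_def)

lemma upper_bound_eq_gen_upper_cluster_algebra:
  assumes "\<And>t. mutation_equivalent n m d s t \<Longrightarrow> upper_bound R n m d t = upper_bound R n m d s"
  shows "upper_bound R n m d s = gen_upper_cluster_algebra R n m d s"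
proof
  show "upper_bound R n m d s \<subseteq> gen_upper_cluster_algebra R n m d s"
    using assms upper_bound_subset unfolding gen_upper_cluster_algebra_def by blast
  show "gen_upper_cluster_algebra R n m d s \<subseteq> upper_bound R n m d s"
    using mutation_equivalent_refl[of n m d s] mutation_equivalent_mutate[of n m d s s]
    unfolding gen_upper_cluster_algebra_def upper_bound_def by blast
qed

text \<open>Under algebraic independence this characterizes the vanishing of the \<open>i\<close>-th exchange
  polynomial. In this form it does not refer to the cluster and is invariant under
  mutation.\<close>

definition zero_direction ::
  "nat \<Rightarrow> nat \<Rightarrow> (nat \<Rightarrow> nat) \<Rightarrow> nat \<Rightarrow> (nat \<Rightarrow> nat \<Rightarrow> 'a::field) \<Rightarrow> (nat \<Rightarrow> nat \<Rightarrow> int) \<Rightarrow> bool" where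
  "zero_direction n m d i \<rho> B \<longleftrightarrow> (\<forall>k\<in>{1..n+m}. B k i = 0) \<and> (\<Sum>j\<in>{0..d i}. \<rho> i j) = 0"

lemma zero_column_mutate:
  assumes "j \<in> {1..n}"
  shows "(\<forall>k\<in>{1..n+m}. mutate_matrix j B k i = 0) \<longleftrightarrow> (\<forall>k\<in>{1..n+m}. B k i = 0)"
proof -
  have j: "j \<in> {1..n+m}" using assms by auto
  have imp: "\<forall>k\<in>{1..n+m}. mutate_matrix j B k i = 0" if "\<forall>k\<in>{1..n+m}. B k i = 0" for B
    using that j by (auto simp: mutate_matrix_def)
  from imp[of B] imp[of "mutate_matrix j B"] show ?thesis by (auto simp: mutate_matrix_involutive)
qed

lemma zero_direction_mutate:
  assumes "j \<in> {1..n}"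
  shows "zero_direction n m d i (\<rho>(j := (\<lambda>l. \<rho> j (d j - l)))) (mutate_matrix j B) \<longleftrightarrow>
    zero_direction n m d i \<rho> B"
proof -
  have "(\<Sum>l\<in>{0..d j}. \<rho> j (d j - l)) = (\<Sum>l\<in>{0..d j}. \<rho> j l)"
    by (rule sum.reindex_bij_witness[of _ "\<lambda>l. d j - l" "\<lambda>l. d j - l"]) auto
  then show ?thesis using zero_column_mutate[OF assms, of m B i] by (simp add: zero_direction_def)
qed

section \<open>Seeds with nonzero exchange polynomials\<close>

definition regular_seed :: "'a::field set \<Rightarrow> nat \<Rightarrow> nat \<Rightarrow> (nat \<Rightarrow> nat) \<Rightarrow> 'a gseed \<Rightarrow> bool" where
  "regular_seed R n m d = (\<lambda>(x, \<rho>, B). alg_independent R x {1..n+m} \<and> seed_matrix n m d B \<and>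
     seed_coeffs R n m d x \<rho> \<and> (\<forall>i\<in>{1..n}. \<not> zero_direction n m d i \<rho> B))"

context
  fixes R :: "'a::field set" and n m :: nat and d :: "nat \<Rightarrow> nat"
  assumes R: "is_subring R"
begin

lemma regular_seed_exchange_poly_nonzero:
  assumes "regular_seed R n m d s" and i: "i \<in> {1..n}"
  shows "exchange_poly n m d s i \<noteq> 0"
proof -
  obtain x \<rho> B where s: "s = (x, \<rho>, B)" by (cases s) auto
  have *: "alg_independent R x {1..n+m}" "seed_matrix n m d B" "seed_coeffs R n m d x \<rho>"
    "\<not> zero_direction n m d i \<rho> B"
    using assms by (auto simp: regular_seed_def s)
  show ?thesis
  proof (cases "\<forall>k\<in>{1..n+m}. B k i = 0")
    case True
    then show ?thesis
      using *(4) exchange_poly_zero_column[of n m B i d x \<rho>] unfolding s zero_direction_def by simp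
  next
    case False
    then show ?thesis using exchange_poly_nonzero[OF R *(1,3) i *(2)] unfolding s by blast
  qed
qed

lemma regular_seed_mutate:
  assumes s: "regular_seed R n m d s" and i: "i \<in> {1..n}"
  shows "regular_seed R n m d (mutate n m d i s)"
proof -
  obtain x \<rho> B where s_eq: "s = (x, \<rho>, B)" by (cases s) auto
  have *: "alg_independent R x {1..n+m}" "seed_matrix n m d B" "seed_coeffs R n m d x \<rho>"
    "\<And>j. j \<in> {1..n} \<Longrightarrow> \<not> zero_direction n m d j \<rho> B"
    using s by (auto simp: regular_seed_def s_eq)
  let ?f = "exchange_poly n m d (x, \<rho>, B) i"
  have "?f \<in> poly_ring R x ({1..n+m} - {i})"
    by (rule exchange_poly_in_poly_ring[OF *(3) i]) (use i seed_matrix_diag[OF *(2) i] in auto)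
  then have "alg_independent R (x(i := ?f / x i)) {1..n+m}"
    using regular_seed_exchange_poly_nonzero[OF s i] i
    by (intro alg_independent_exchange R *) (auto simp: s_eq)
  then show ?thesis
    using seed_matrix_mutate[OF *(2) i] seed_coeffs_mutate[OF *(3) i] *(4) zero_direction_mutate[OF i]
    unfolding s_eq mutate.simps regular_seed_def by blast
qed

lemma cluster_mutate_twice:
  assumes s: "regular_seed R n m d s" and i: "i \<in> {1..n}"
  shows "cluster (mutate n m d i (mutate n m d i s)) = cluster s"
    "j \<in> {1..n} \<Longrightarrow> cluster (mutate n m d j (mutate n m d i (mutate n m d i s))) = cluster (mutate n m d j s)"
proof -
  obtain x \<rho> B where s_eq: "s = (x, \<rho>, B)" by (cases s) auto
  have B: "seed_matrix n m d B" using s by (auto simp: regular_seed_def s_eq)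
  define f where "f = exchange_poly n m d (x, \<rho>, B) i"
  \<comment> \<open>the double reversal restores the coefficients with index at most \<open>d i\<close> only, because
    subtraction is truncated; exchange polynomials involve no others\<close>
  define \<rho>'' where "\<rho>'' = \<rho>(i := (\<lambda>j. \<rho> i (d i - (d i - j))))"
  have f0: "f \<noteq> 0" using regular_seed_exchange_poly_nonzero[OF s i] by (simp add: f_def s_eq)
  have once: "mutate n m d i s = (x(i := f / x i), \<rho>(i := (\<lambda>j. \<rho> i (d i - j))), mutate_matrix i B)"
    by (simp add: s_eq f_def)
  have "exchange_poly n m d (mutate n m d i s) i = f"
    unfolding s_eq f_def by (rule exchange_poly_mutate_same[OF B i])
  then have twice: "mutate n m d i (mutate n m d i s) = (x, \<rho>'', B)"
    using f0 unfolding once mutate.simps by (simp add: mutate_matrix_involutive \<rho>''_def fun_eq_iff)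
  then show "cluster (mutate n m d i (mutate n m d i s)) = cluster s" by (simp add: s_eq)
  show "cluster (mutate n m d j (mutate n m d i (mutate n m d i s))) = cluster (mutate n m d j s)"
    if "j \<in> {1..n}"
  proof -
    have "exchange_poly n m d (x, \<rho>'', B) j = exchange_poly n m d (x, \<rho>, B) j"
      by (rule exchange_poly_cong) (auto simp: \<rho>''_def)
    then show ?thesis unfolding twice unfolding s_eq by (simp only: cluster_mutate)
  qed
qed

lemma upper_bound_mutate_subset:
  assumes G: "gcd_subring R" and s: "regular_seed R n m d s" and i: "i \<in> {1..n}"
    and cop: "\<And>j. j \<in> {1..n} \<Longrightarrow> coprime_seed R n m d (mutate n m d j (mutate n m d i s))"
  shows "upper_bound R n m d s \<subseteq> upper_bound R n m d (mutate n m d i s)"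
proof
  fix y assume y: "y \<in> upper_bound R n m d s"
  obtain x \<rho> B where s_eq: "s = (x, \<rho>, B)" by (cases s) auto
  have *: "alg_independent R x {1..n+m}" "seed_matrix n m d B" "seed_coeffs R n m d x \<rho>"
    using s by (auto simp: regular_seed_def s_eq)
  have ys: "y \<in> laurent_ring R (cluster s) {1..n+m}"
    and yj: "\<And>j. j \<in> {1..n} \<Longrightarrow> y \<in> laurent_ring R (cluster (mutate n m d j s)) {1..n+m}"
    using y by (auto simp: upper_bound_def)
  have "y \<in> laurent_ring R (cluster (mutate n m d j (mutate n m d i s))) {1..n+m}" if j: "j \<in> {1..n}" for j
  proof (cases "j = i")
    case True
    then show ?thesis using ys cluster_mutate_twice(1)[OF s i] by simp
  next
    case False
    then show ?thesis
      using laurent_ring_exchange_inclusion[OF R G * (1,3,2) i j]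
        regular_seed_exchange_poly_nonzero[OF s i]
        regular_seed_exchange_poly_nonzero[OF regular_seed_mutate[OF s i] j] cop[OF j] yj[OF i] yj[OF j]
      unfolding s_eq by blast
  qed
  then show "y \<in> upper_bound R n m d (mutate n m d i s)"
    using yj[OF i] by (simp add: upper_bound_def)
qed

lemma upper_bound_regular_seed:
  assumes G: "gcd_subring R" and s: "regular_seed R n m d s"
    and cop: "\<And>t. mutation_equivalent n m d s t \<Longrightarrow> coprime_seed R n m d t"
    and t: "mutation_equivalent n m d s t"
  shows "upper_bound R n m d t = upper_bound R n m d s"
proof -
  from t have "regular_seed R n m d t \<and> upper_bound R n m d t = upper_bound R n m d s"
  proof (induction rule: mutation_equivalent_induct)
    case refl
    then show ?case using s by simp
  next
    case (mutate t i)
    let ?t' = "Defs.mutate n m d i t"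
    have reg: "regular_seed R n m d t" and i: "i \<in> {1..n}" using mutate by auto
    have reg': "regular_seed R n m d ?t'" by (rule regular_seed_mutate[OF reg i])
    have "upper_bound R n m d t \<subseteq> upper_bound R n m d ?t'"
      by (intro upper_bound_mutate_subset G reg i cop mutation_equivalent_mutate mutate(1))
    moreover have "upper_bound R n m d ?t' \<subseteq> upper_bound R n m d (Defs.mutate n m d i ?t')"
      by (intro upper_bound_mutate_subset G reg' i cop mutation_equivalent_mutate mutate(1))
    moreover have "upper_bound R n m d (Defs.mutate n m d i ?t') = upper_bound R n m d t"
      by (intro upper_bound_cong cluster_mutate_twice[OF reg i])
    ultimately show ?case using mutate.IH reg' by simp
  qed
  then show ?thesis by blast
qed

end

section \<open>Seeds with a vanishing exchange polynomial\<close>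

definition degenerate_seed ::
  "'a::field set \<Rightarrow> nat \<Rightarrow> nat \<Rightarrow> (nat \<Rightarrow> nat) \<Rightarrow> nat \<Rightarrow> 'a gseed \<Rightarrow> bool" where
  "degenerate_seed R n m d i = (\<lambda>(x, \<rho>, B). seed_matrix n m d B \<and> seed_coeffs R n m d x \<rho> \<and>
     zero_direction n m d i \<rho> B)"

lemma degenerate_seed_exchange_poly:
  assumes "degenerate_seed R n m d i s" shows "exchange_poly n m d s i = 0"
proof -
  obtain x \<rho> B where s_eq: "s = (x, \<rho>, B)" by (cases s) auto
  have "zero_direction n m d i \<rho> B" using assms by (simp add: degenerate_seed_def s_eq)
  then show ?thesis
    unfolding s_eq using exchange_poly_zero_column[of n m B i d x \<rho>] by (simp add: zero_direction_def)
qed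

lemma degenerate_seed_mutate:
  assumes "degenerate_seed R n m d i s" "j \<in> {1..n}"
  shows "degenerate_seed R n m d i (mutate n m d j s)"
proof -
  obtain x \<rho> B where s_eq: "s = (x, \<rho>, B)" by (cases s) auto
  show ?thesis
    using assms seed_matrix_mutate seed_coeffs_mutate zero_direction_mutate
    unfolding s_eq degenerate_seed_def mutate.simps by blast
qed

lemma degenerate_seed_cluster_mutate:
  assumes "degenerate_seed R n m d i s"
  shows "cluster (mutate n m d i s) = (cluster s)(i := 0)"
proof -
  obtain x \<rho> B where s_eq: "s = (x, \<rho>, B)" by (cases s) auto
  show ?thesis using degenerate_seed_exchange_poly[OF assms]
    unfolding s_eq cluster_mutate by simp
qed

text \<open>After mutation in direction \<open>i\<close> the \<open>i\<close>-th exchange polynomial is still \<open>0\<close> and the \<open>j\<close>-th one is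
  unchanged; it divides \<open>0\<close> and itself, so coprimality makes it divide \<open>1\<close>.\<close>

lemma degenerate_seed_exchange_poly_unit:
  assumes s: "degenerate_seed R n m d i s" and i: "i \<in> {1..n}" and j: "j \<in> {1..n}" "j \<noteq> i"
    and cop: "coprime_seed R n m d (mutate n m d i s)"
  defines "P \<equiv> poly_ring R ((cluster s)(i := 0)) {1..n+m}"
  shows "unit_within P (exchange_poly n m d s j)"
proof -
  obtain x \<rho> B where s_eq: "s = (x, \<rho>, B)" by (cases s) auto
  let ?t = "mutate n m d i s" and ?f = "exchange_poly n m d s j"
  have B: "seed_matrix n m d B" and zero: "zero_direction n m d i \<rho> B"
    using s by (auto simp: degenerate_seed_def s_eq)
  have cl: "cluster ?t = (cluster s)(i := 0)" by (rule degenerate_seed_cluster_mutate[OF s])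
  have "B j i = 0" using zero j by (auto simp: zero_direction_def)
  then have "B i j = 0" by (rule seed_matrix_zero_sym[OF B j(1) i])
  then have fj: "exchange_poly n m d ?t j = ?f"
    unfolding s_eq by (rule exchange_poly_mutate_other[OF j(2)])
  have fi: "exchange_poly n m d ?t i = 0"
    by (rule degenerate_seed_exchange_poly[OF degenerate_seed_mutate[OF s i]])
  have "coprime_in P (exchange_poly n m d ?t i) (exchange_poly n m d ?t j)"
    using cop[unfolded coprime_seed_def, rule_format, OF i j(1) j(2)[symmetric]]
    unfolding cl P_def .
  then have cop0: "coprime_in P 0 ?f" unfolding fi fj .
  have P: "is_subring P" unfolding P_def by (rule is_subring_poly_ring)
  obtain x' \<rho>' B' where t_eq: "?t = (x', \<rho>', B')" by (cases ?t) auto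
  have "seed_coeffs R n m d x' \<rho>'"
    using degenerate_seed_mutate[OF s i] unfolding t_eq degenerate_seed_def by simp
  then have "exchange_poly n m d ?t j \<in> poly_ring R x' {1..n+m}"
    unfolding t_eq by (rule exchange_poly_in_poly_ring[OF _ j(1)]) auto
  moreover have "x' = (cluster s)(i := 0)" using cl by (simp add: t_eq)
  ultimately have fP: "?f \<in> P" by (simp add: fj P_def)
  have "0 = ?f * 0" "?f = ?f * 1" by simp_all
  then have "divides_in P ?f 0" "divides_in P ?f ?f"
    using subring_0[OF P] subring_1[OF P] unfolding divides_in_def by blast+
  then have "divides_in P ?f 1" using cop0 fP unfolding coprime_in_def by blast
  then obtain c where c: "c \<in> P" "?f * c = 1" unfolding divides_in_def by metis
  then have "c = inverse ?f" "?f \<noteq> 0" by (auto intro: inverse_unique[symmetric])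
  with c fP show ?thesis by (simp add: unit_within_def)
qed

text \<open>Setting the \<open>i\<close>-th variable to \<open>0\<close> removes it from the generators, since also \<open>inverse 0 = 0\<close>. This
  is the Laurent ring after mutation in a direction with vanishing exchange polynomial.\<close>

definition reduced_ring :: "'a::field set \<Rightarrow> nat \<Rightarrow> nat \<Rightarrow> nat \<Rightarrow> 'a gseed \<Rightarrow> 'a set" where
  "reduced_ring R n m i s = laurent_ring R ((cluster s)(i := 0)) {1..n+m}"

text \<open>A mutation in another direction \<open>j\<close> replaces \<open>x j\<close> by a unit divided by \<open>x j\<close>.\<close>

lemma reduced_ring_mutate_subset:
  assumes s: "degenerate_seed R n m d i s" and i: "i \<in> {1..n}" and j: "j \<in> {1..n}"
    and cop: "coprime_seed R n m d (mutate n m d i s)"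
  shows "reduced_ring R n m i (mutate n m d j s) \<subseteq> reduced_ring R n m i s"
proof (cases "j = i")
  case True
  then show ?thesis
    unfolding reduced_ring_def using degenerate_seed_cluster_mutate[OF s] by simp
next
  case False
  obtain x \<rho> B where s_eq: "s = (x, \<rho>, B)" by (cases s) auto
  let ?f = "exchange_poly n m d s j" and ?M = "reduced_ring R n m i s"
  have M: "is_subring ?M" unfolding reduced_ring_def by (rule is_subring_laurent_ring)
  have "poly_ring R ((cluster s)(i := 0)) {1..n+m} \<subseteq> ?M"
    unfolding reduced_ring_def by (rule poly_ring_subset_laurent_ring)
  then have f: "?f \<in> ?M" "inverse ?f \<in> ?M"
    using degenerate_seed_exchange_poly_unit[OF s i j False cop] by (auto simp: unit_within_def)
  have gen: "(x(i := 0)) k \<in> ?M" "inverse ((x(i := 0)) k) \<in> ?M" if "k \<in> {1..n+m}" for k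
    using that unfolding reduced_ring_def s_eq fst_conv
    by (intro var_in_laurent_ring inverse_in_laurent_ring; assumption)+
  have jV: "j \<in> {1..n+m}" using j by auto
  have xj: "x j \<in> ?M" "inverse (x j) \<in> ?M" using gen[OF jV] False by simp_all
  have "cluster (mutate n m d j s) = x(j := ?f / x j)" by (simp only: s_eq cluster_mutate)
  then have "reduced_ring R n m i (mutate n m d j s) = laurent_ring R (x(j := ?f / x j, i := 0)) {1..n+m}"
    by (simp add: reduced_ring_def)
  also have "\<dots> \<subseteq> ?M"
  proof (rule laurent_ring_least[OF M])
    show "R \<subseteq> ?M" unfolding reduced_ring_def by (auto intro: coeff_in_laurent_ring)
    show "(x(j := ?f / x j, i := 0)) k \<in> ?M" if "k \<in> {1..n+m}" for k
    proof (cases "k = j")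
      case True
      have "?f * inverse (x j) \<in> ?M" by (intro subring_mult[OF M] f xj)
      then show ?thesis using True False by (simp add: divide_inverse)
    qed (use gen(1)[OF that] in \<open>simp split: if_splits\<close>)
    show "inverse ((x(j := ?f / x j, i := 0)) k) \<in> ?M" if "k \<in> {1..n+m}" for k
    proof (cases "k = j")
      case True
      have "inverse ?f * x j \<in> ?M" by (intro subring_mult[OF M] f xj)
      then show ?thesis using True False by (simp add: divide_inverse)
    qed (use gen(2)[OF that] in \<open>simp split: if_splits\<close>)
  qed
  finally show ?thesis .
qed

text \<open>The converse inclusion is the previous one for the mutated seed, because mutating twice
  restores the reduced ring.\<close>

lemma reduced_ring_mutate:
  assumes s: "degenerate_seed R n m d i s" and i: "i \<in> {1..n}" and j: "j \<in> {1..n}"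
    and cop: "coprime_seed R n m d (mutate n m d i s)"
      "coprime_seed R n m d (mutate n m d i (mutate n m d j s))"
  shows "reduced_ring R n m i (mutate n m d j s) = reduced_ring R n m i s"
proof
  show "reduced_ring R n m i (mutate n m d j s) \<subseteq> reduced_ring R n m i s"
    by (rule reduced_ring_mutate_subset[OF s i j cop(1)])
  have "reduced_ring R n m i (mutate n m d j (mutate n m d j s)) = reduced_ring R n m i s"
  proof (cases "j = i")
    case True
    then show ?thesis unfolding reduced_ring_def
      using degenerate_seed_cluster_mutate[OF s]
        degenerate_seed_cluster_mutate[OF degenerate_seed_mutate[OF s i]] by simp
  next
    case False
    obtain x \<rho> B where s_eq: "s = (x, \<rho>, B)" by (cases s) auto
    have B: "seed_matrix n m d B" using s by (simp add: degenerate_seed_def s_eq)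
    let ?f = "exchange_poly n m d s j"
    have f0: "?f \<noteq> 0"
      using degenerate_seed_exchange_poly_unit[OF s i j False cop(1)] by (simp add: unit_within_def)
    obtain x' \<rho>' B' where t_eq: "mutate n m d j s = (x', \<rho>', B')" by (cases "mutate n m d j s") auto
    have x': "x' = x(j := ?f / x j)"
      using arg_cong[OF t_eq, of cluster] unfolding s_eq cluster_mutate by simp
    have "exchange_poly n m d (x', \<rho>', B') j = ?f"
      unfolding t_eq[symmetric] s_eq by (rule exchange_poly_mutate_same[OF B j])
    then have "cluster (mutate n m d j (mutate n m d j s)) = x'(j := ?f / x' j)"
      unfolding t_eq cluster_mutate by simp
    also have "\<dots> = x" using f0 by (simp add: x')
    finally show ?thesis by (simp add: reduced_ring_def s_eq)
  qed
  then show "reduced_ring R n m i s \<subseteq> reduced_ring R n m i (mutate n m d j s)"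
    using reduced_ring_mutate_subset[OF degenerate_seed_mutate[OF s j] i j cop(2)] by simp
qed

lemma upper_bound_degenerate_seed_eq_reduced_ring:
  assumes s: "degenerate_seed R n m d i s" and i: "i \<in> {1..n}"
    and cop: "coprime_seed R n m d (mutate n m d i s)"
      "\<And>j. j \<in> {1..n} \<Longrightarrow> coprime_seed R n m d (mutate n m d i (mutate n m d j s))"
  shows "upper_bound R n m d s = reduced_ring R n m i s"
proof
  have sub: "reduced_ring R n m i t \<subseteq> laurent_ring R (cluster t) {1..n+m}" for t :: "'a gseed"
    unfolding reduced_ring_def
    by (rule laurent_ring_least)
      (auto intro: is_subring_laurent_ring coeff_in_laurent_ring var_in_laurent_ring
        inverse_in_laurent_ring subring_0)
  have "laurent_ring R (cluster (mutate n m d i s)) {1..n+m} = reduced_ring R n m i s"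
    by (simp only: reduced_ring_def degenerate_seed_cluster_mutate[OF s])
  then show "upper_bound R n m d s \<subseteq> reduced_ring R n m i s"
    using i unfolding upper_bound_def by blast
  have "reduced_ring R n m i s \<subseteq> laurent_ring R (cluster (mutate n m d j s)) {1..n+m}"
    if "j \<in> {1..n}" for j
    using sub[of "mutate n m d j s"] reduced_ring_mutate[OF s i that cop(1) cop(2)[OF that]] by simp
  then show "reduced_ring R n m i s \<subseteq> upper_bound R n m d s"
    using sub[of s] unfolding upper_bound_def by blast
qed

lemma upper_bound_degenerate_seed:
  assumes s: "degenerate_seed R n m d i s" and i: "i \<in> {1..n}"
    and cop: "\<And>t. mutation_equivalent n m d s t \<Longrightarrow> coprime_seed R n m d t"
    and t: "mutation_equivalent n m d s t"
  shows "upper_bound R n m d t = upper_bound R n m d s"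
proof -
  have ub: "upper_bound R n m d t = reduced_ring R n m i t"
    if "mutation_equivalent n m d s t" "degenerate_seed R n m d i t" for t
    by (rule upper_bound_degenerate_seed_eq_reduced_ring[OF that(2) i])
      (intro cop mutation_equivalent_mutate that(1) i; assumption)+
  from t have "degenerate_seed R n m d i t \<and> reduced_ring R n m i t = reduced_ring R n m i s"
  proof (induction rule: mutation_equivalent_induct)
    case refl
    then show ?case using s by simp
  next
    case (mutate t j)
    have deg: "degenerate_seed R n m d i t" and j: "j \<in> {1..n}" using mutate by blast+
    have "reduced_ring R n m i (Defs.mutate n m d j t) = reduced_ring R n m i t"
      by (intro reduced_ring_mutate[OF deg i j] cop mutation_equivalent_mutate mutate(1) i j)
    with mutate.IH degenerate_seed_mutate[OF deg j] show ?case by simp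
  qed
  then show ?thesis using ub[OF t] ub[OF mutation_equivalent_refl s] by simp
qed

theorem corollary3p5:
  fixes R F :: "'a::field_char_0 set"
    and n m :: nat
    and d :: "nat \<Rightarrow> nat"
    and x :: "nat \<Rightarrow> 'a"
    and \<rho> :: "nat \<Rightarrow> nat \<Rightarrow> 'a"
    and B :: "nat \<Rightarrow> nat \<Rightarrow> int"
  assumes "n + m > 0"
    and "R = \<int> \<or> is_subfield R"
    and "is_rational_function_field (quotient_field R) (n + m) F"
    and "generalized_seed R F n m d (x, \<rho>, B)"
    and "\<forall>t. mutation_equivalent n m d (x, \<rho>, B) t \<longrightarrow> coprime_seed R n m d t"
  shows "(\<forall>t. mutation_equivalent n m d (x, \<rho>, B) t \<longrightarrow>
             upper_bound R n m d t = upper_bound R n m d (x, \<rho>, B)) \<and>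
         upper_bound R n m d (x, \<rho>, B) = gen_upper_cluster_algebra R n m d (x, \<rho>, B)"
proof -
  have "is_subring (\<int> :: 'a set)" by (simp add: is_subring_def)
  with assms(2) have R: "is_subring R" "gcd_subring R"
    by (elim disjE; simp add: gcd_subring_Ints gcd_subring_subfield is_subfield_def)+
  have seed: "alg_independent R x {1..n+m}" "seed_matrix n m d B" "seed_coeffs R n m d x \<rho>"
    using assms(4) unfolding generalized_seed.simps seed_matrix_def seed_coeffs_def by blast+
  have const: "upper_bound R n m d t = upper_bound R n m d (x, \<rho>, B)"
    if t: "mutation_equivalent n m d (x, \<rho>, B) t" for t
  proof (cases "\<exists>i\<in>{1..n}. zero_direction n m d i \<rho> B")
    case True
    then obtain i where i: "i \<in> {1..n}" "zero_direction n m d i \<rho> B" by blast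
    then have "degenerate_seed R n m d i (x, \<rho>, B)" using seed by (simp add: degenerate_seed_def)
    then show ?thesis
      by (rule upper_bound_degenerate_seed[OF _ i(1) assms(5)[rule_format] t])
  next
    case False
    then have "regular_seed R n m d (x, \<rho>, B)" using seed by (simp add: regular_seed_def)
    then show ?thesis by (rule upper_bound_regular_seed[OF R _ assms(5)[rule_format] t])
  qed
  with upper_bound_eq_gen_upper_cluster_algebra[OF const] show ?thesis by blast
qed

end
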